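(* Let $H_n$ be the Hermite polynomials. In the region $-\sqrt{2n}\ll\xi\ll\sqrt{2n}$, as $n\to\infty$, $$H_n(\xi)\sim\Lambda_5(\xi)\equiv\Lambda_1(\xi)+\Lambda_2(\xi).$$ Writing $\xi=\sqrt{2n}\sin\theta$ with $-\frac\pi2<\theta<\frac\pi2$, so that $\sigma=\mathrm i\sqrt{2n}\cos\theta$, one has $$\Lambda_5\left(\sqrt{2n}\sin\theta\right)=\sqrt{\frac{2}{\cos\theta}}\,\exp\left\{\frac n2\left[\ln(2n)-\cos(2\theta)\right]\right\}\cos(\Theta),\qquad \Theta=n\left[\frac12\sin(2\theta)+\theta-\frac\pi2\right]+\frac\theta2.$$ Equivalently, in terms of $\xi$, $$\Lambda_5(\xi)=\sqrt2\left(1-\frac{\xi^2}{2n}\right)^{-1/4}\exp\left\{\frac n2[\ln(2n)-1]+\frac{\xi^2}{2}\right\}\cos\left[\frac\xi2\sqrt{2n-\xi^2}+\left(n+\frac12\right)\arcsin\left(\frac{\xi}{\sqrt{2n}}\right)-\frac{n\pi}{2}\right].$$ Considering the leading term of this expression as $n\to\infty$, $$\Lambda_5(\xi)\sim\sqrt2\,\exp\left\{\frac n2[\ln(2n)-1]+\frac{\xi^2}{2}\right\}\cos\left(\frac{n\pi}{2}-\xi\sqrt{2n}\right).$$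
   Context: The Hermite polynomials are $H_n(x)=n!\sum_{k=0}^{\lfloor n/2\rfloor}\frac{(-1)^k}{k!(n-2k)!}(2x)^{n-2k}$, $n=0,1,2,\ldots$. With $\sigma=\sqrt{\xi^2-2n}$, the functions $\Lambda_1$ and $\Lambda_2$ are $$\Lambda_1(\xi)=(-1)^n\exp\left[n\ln(\sigma-\xi)+\frac{\xi^2+\sigma\xi-n}{2}\right]\sqrt{\frac12\left(1-\frac{\xi}{\sigma}\right)},$$ $$\Lambda_2(\xi)=\exp\left[n\ln(\sigma+\xi)+\frac{\xi^2-\sigma\xi-n}{2}\right]\sqrt{\frac12\left(1+\frac{\xi}{\sigma}\right)}.$$
   Formalization: Since a quotient limit fails near zeros of the cosine, ∼ is read as: error o(amplitude), uniformly, and quotient → 1 where |cos| ≥ η, for each η > 0. The region is |ξ| ≤ (1−δ)√(2n) for each δ in (0,1); in the last relation, false for large ξ, ξ is bounded. *)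

theory Defs
  imports "HOL-Analysis.Analysis" "HOL-Library.Landau_Symbols"
begin

definition Hermite :: "nat \<Rightarrow> real \<Rightarrow> real" where
  "Hermite n x = fact n *
     (\<Sum>k = 0..n div 2. (-1) ^ k / (fact k * fact (n - 2 * k)) * (2 * x) ^ (n - 2 * k))"

(* All square roots and logarithms in sigma, Lambda1, Lambda2 are complex principal branches;
   for \<xi>^2 < 2n the value sigma n \<xi> lies on the positive imaginary axis. *)

definition sigma :: "nat \<Rightarrow> real \<Rightarrow> complex" where
  "sigma n \<xi> = csqrt (of_real (\<xi>\<^sup>2 - 2 * real n))"

definition Lambda1 :: "nat \<Rightarrow> real \<Rightarrow> complex" where
  "Lambda1 n \<xi> = (-1) ^ n
     * exp (of_nat n * ln (sigma n \<xi> - of_real \<xi>)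
            + ((of_real \<xi>)\<^sup>2 + sigma n \<xi> * of_real \<xi> - of_nat n) / 2)
     * csqrt (1 / 2 * (1 - of_real \<xi> / sigma n \<xi>))"

definition Lambda2 :: "nat \<Rightarrow> real \<Rightarrow> complex" where
  "Lambda2 n \<xi> =
     exp (of_nat n * ln (sigma n \<xi> + of_real \<xi>)
            + ((of_real \<xi>)\<^sup>2 - sigma n \<xi> * of_real \<xi> - of_nat n) / 2)
     * csqrt (1 / 2 * (1 + of_real \<xi> / sigma n \<xi>))"

definition Lambda5 :: "nat \<Rightarrow> real \<Rightarrow> complex" where
  "Lambda5 n \<xi> = Lambda1 n \<xi> + Lambda2 n \<xi>"

definition Theta :: "nat \<Rightarrow> real \<Rightarrow> real" where
  "Theta n \<theta> = real n * (1 / 2 * sin (2 * \<theta>) + \<theta> - pi / 2) + \<theta> / 2"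

(* Amplitude and phase of Lambda5 in terms of \<xi>. *)

definition amplitude5 :: "nat \<Rightarrow> real \<Rightarrow> real" where
  "amplitude5 n \<xi> = sqrt 2 * (1 - \<xi>\<^sup>2 / (2 * real n)) powr (- 1 / 4)
     * exp (real n / 2 * (ln (2 * real n) - 1) + \<xi>\<^sup>2 / 2)"

definition phase5 :: "nat \<Rightarrow> real \<Rightarrow> real" where
  "phase5 n \<xi> = \<xi> / 2 * sqrt (2 * real n - \<xi>\<^sup>2)
     + (real n + 1 / 2) * arcsin (\<xi> / sqrt (2 * real n)) - real n * pi / 2"

(* Amplitude and phase of the leading term of Lambda5 for \<xi> = O(1). *)

definition amplitude5_lead :: "nat \<Rightarrow> real \<Rightarrow> real" where
  "amplitude5_lead n \<xi> = sqrt 2 * exp (real n / 2 * (ln (2 * real n) - 1) + \<xi>\<^sup>2 / 2)"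

definition phase5_lead :: "nat \<Rightarrow> real \<Rightarrow> real" where
  "phase5_lead n \<xi> = real n * pi / 2 - \<xi> * sqrt (2 * real n)"

(* The filter "n tends to infinity, uniformly in \<xi> \<in> S n". Since the functions compared here
   oscillate and their zeros do not coincide, the quotient f / g cannot tend to 1 on
   neighbourhoods of the zeros of g.  The relation f \<sim> g for oscillating g = a * cos \<phi> means
   f - g = o(a) for the amplitude a, and f / g \<longrightarrow> 1 wherever \<bar>cos \<phi>\<bar> is bounded away from 0. *)

definition uniformly_in :: "(nat \<Rightarrow> real set) \<Rightarrow> (nat \<times> real) filter" where
  "uniformly_in S = inf (filtercomap fst sequentially) (principal (SIGMA n:UNIV. S n))"

definition osc_asymp_equiv ::
  "(nat \<Rightarrow> real set) \<Rightarrow> (nat \<Rightarrow> real \<Rightarrow> complex) \<Rightarrow> (nat \<Rightarrow> real \<Rightarrow> complex)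
     \<Rightarrow> (nat \<Rightarrow> real \<Rightarrow> real) \<Rightarrow> (nat \<Rightarrow> real \<Rightarrow> real) \<Rightarrow> bool" where
  "osc_asymp_equiv S f g a \<phi> \<longleftrightarrow>
     (\<lambda>(n, \<xi>). f n \<xi> - g n \<xi>) \<in> o[uniformly_in S](\<lambda>(n, \<xi>). of_real (a n \<xi>)) \<and>
     (\<forall>\<eta>>0. (\<lambda>(n, \<xi>). f n \<xi>)
        \<sim>[uniformly_in (\<lambda>n. {\<xi> \<in> S n. \<eta> \<le> \<bar>cos (\<phi> n \<xi>)\<bar>})] (\<lambda>(n, \<xi>). g n \<xi>))"

lemma eventually_uniformly_in:
  "eventually P (uniformly_in S) \<longleftrightarrow> (\<exists>N. \<forall>n\<ge>N. \<forall>\<xi>\<in>S n. P (n, \<xi>))"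
  unfolding uniformly_in_def eventually_inf_principal eventually_filtercomap
    eventually_sequentially
proof safe
  fix Q N
  assume "\<forall>x. Q (fst x) \<longrightarrow> x \<in> (SIGMA n:UNIV. S n) \<longrightarrow> P x" "\<forall>n\<ge>N. Q n"
  then show "\<exists>N. \<forall>n\<ge>N. \<forall>\<xi>\<in>S n. P (n, \<xi>)" by fastforce
next
  fix N assume "\<forall>n\<ge>N. \<forall>\<xi>\<in>S n. P (n, \<xi>)"
  then show "\<exists>Q. (\<exists>N. \<forall>n\<ge>N. Q n) \<and> (\<forall>x. Q (fst x) \<longrightarrow> x \<in> (SIGMA n:UNIV. S n) \<longrightarrow> P x)"
    by (intro exI[of _ "\<lambda>n. n \<ge> N"]) auto
qed

end

(* Put N = 2n and xi = sqrt N * t.  The rescaled Hermite function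
   exp(-n t^2) H_n(sqrt N t) / (sqrt 2 (2n/e)^(n/2)) solves
   w'' = -(N^2 (1 - t^2) + N) w, and the claimed leading term (1 - t^2)^(-1/4) cos(phase)
   solves the same equation up to a residual that is bounded independently of N on
   |t| <= 1 - delta.  For t >= 0 the coefficient decreases, so the energy
   w'^2 + (N^2 (1 - t^2) + N) w^2 of the difference w grows at most by a bounded factor plus a
   bounded amount; divided by N^2, it is initially o(1) because n! ~ C sqrt n (n/e)^n, where
   the constant C cancels in (2m)!/m!.  Parity covers t < 0. *)

theory Submission
  imports Defs "HOL-Real_Asymp.Real_Asymp"
begin

text \<open>The energy controls only N times the error, so the residual of the comparison function
  must be o(N); a residual of order N would leave an error of order 1. This is why the phase carries
  (arcsin t)/2 beyond the classical (N/2)(t sqrt(1 - t^2) + arcsin t): the extra term accounts for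
  the summand N in the coefficient. The shift -n pi/2 is dictated by the data at the origin, where
  H_n(0) and H_n'(0) vanish alternately and follow cos(n pi/2) and sin(n pi/2). Keeping |t| <= 1 -
  delta avoids the turning points near t = 1 and t = -1, where amplitude and residual blow up and
  the coefficient loses its factor N^2. The other side needs no asymptotics: for |xi| < sqrt(2n) the
  two saddle contributions are complex conjugates with an explicit polar form, so their sum is
  exactly amplitude times cosine.\<close>

section \<open>Hermite polynomials\<close>

text \<open>Since \<open>n - 2 * k\<close> truncates, the terms with 2k > n are set to 0 explicitly.
  Sums for different degrees then share one index range and can be compared term by term.\<close>

lemma Hermite_eq_sum:
  assumes "n div 2 \<le> m"
  shows "Hermite n x = (\<Sum>k\<le>m. if 2 * k \<le> n
           then (-1) ^ k * fact n / (fact k * fact (n - 2 * k)) * (2 * x) ^ (n - 2 * k) else 0)"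
proof -
  have "Hermite n x = (\<Sum>k\<in>{0..n div 2}.
      (-1) ^ k * fact n / (fact k * fact (n - 2 * k)) * (2 * x) ^ (n - 2 * k))"
    unfolding Hermite_def sum_distrib_left by (intro sum.cong) auto
  also have "\<dots> = (\<Sum>k\<le>m. if 2 * k \<le> n
           then (-1) ^ k * fact n / (fact k * fact (n - 2 * k)) * (2 * x) ^ (n - 2 * k) else 0)"
    using assms by (intro sum.mono_neutral_cong_left) auto
  finally show ?thesis .
qed

lemma Hermite_0 [simp]: "Hermite 0 x = 1"
  by (simp add: Hermite_def)

lemma has_real_derivative_Hermite:
  "(Hermite n has_real_derivative 2 * real n * Hermite (n - 1) x) (at x)"
proof (cases n)
  case 0
  have "Hermite 0 = (\<lambda>_. 1)" by auto
  then show ?thesis using 0 by simp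
next
  case (Suc l)
  let ?t = "\<lambda>k x. if 2 * k \<le> n
    then (-1) ^ k * fact n / (fact k * fact (n - 2 * k)) * (2 * x) ^ (n - 2 * k) else (0::real)"
  let ?d = "\<lambda>k. 2 * real n * (if 2 * k \<le> l
    then (-1) ^ k * fact l / (fact k * fact (l - 2 * k)) * (2 * x) ^ (l - 2 * k) else 0)"
  have d: "(?t k has_real_derivative ?d k) (at x)" for k
  proof (cases "2 * k \<le> l")
    case True
    then obtain j where j: "l = 2 * k + j" by (auto simp: le_iff_add)
    have "((\<lambda>x. (-1) ^ k * fact n / (fact k * fact (Suc j)) * (2 * x) ^ Suc j) has_real_derivative
       (-1) ^ k * fact n / (fact k * fact (Suc j)) * (real (Suc j) * (2 * x) ^ j * 2)) (at x)"
      by (rule derivative_eq_intros refl)+ (simp del: of_nat_Suc fact_Suc)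
    moreover have "(-1) ^ k * fact n / (fact k * fact (Suc j)) * (real (Suc j) * (2 * x) ^ j * 2) =
        2 * real n * ((-1) ^ k * fact l / (fact k * fact j) * (2 * x) ^ j)"
      unfolding Suc fact_Suc by (simp add: field_simps del: of_nat_Suc)
    ultimately show ?thesis using True j Suc by (simp add: algebra_simps)
  next
    case False
    show ?thesis
    \<comment> \<open>Either 2k = n and the term is constant in x, or 2k > n and it is already
      0.\<close>
    proof (cases "n = 2 * k")
      case True
      then show ?thesis using False by simp
    next
      case f2: False
      then have "\<not> 2 * k \<le> n" using False Suc by auto
      then show ?thesis using False by simp
    qed
  qed
  have "((\<lambda>x. \<Sum>k\<le>n. ?t k x) has_real_derivative (\<Sum>k\<le>n. ?d k)) (at x)"
    by (intro DERIV_sum d)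
  moreover have "(\<lambda>x. \<Sum>k\<le>n. ?t k x) = Hermite n"
    by (intro ext Hermite_eq_sum[symmetric]) auto
  moreover have "(\<Sum>k\<le>n. ?d k) = 2 * real n * Hermite (n - 1) x"
    unfolding sum_distrib_left[symmetric] using Suc Hermite_eq_sum[of l n x]
    by (simp del: sum.atMost_Suc)
  ultimately show ?thesis by simp
qed

text \<open>With a = k + 1 and b = n - 2k, the factor n + 2 = 2a + b in the coefficient of H_(n+2)
  splits through (2a + b)/(ab) = 1/a + 2/b; the two parts are the contributions of H_(n+1) and
  H_n.\<close>

lemma Hermite_Suc_Suc:
  "Hermite (Suc (Suc n)) x = 2 * x * Hermite (Suc n) x - 2 * real (Suc n) * Hermite n x"
proof -
  let ?c = "\<lambda>n k. if 2 * k \<le> n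
    then (-1) ^ k * fact n / (fact k * fact (n - 2 * k)) * (2 * x) ^ (n - 2 * k) else (0::real)"
  have 0: "?c (Suc (Suc n)) 0 = 2 * x * ?c (Suc n) 0"
    by simp
  have S: "?c (Suc (Suc n)) (Suc k) = 2 * x * ?c (Suc n) (Suc k) - 2 * real (Suc n) * ?c n k" for k
  proof (cases "2 * k \<le> n")
    case True
    then obtain j where j: "n = 2 * k + j" by (auto simp: le_iff_add)
    show ?thesis
    proof (cases j)
      \<comment> \<open>Here n = 2k: the term of H_(n+1) with index k + 1 is absent, and n + 2 = 2(k
        + 1) cancels alone.\<close>
      case 0
      have "(fact (Suc (Suc n)) :: real) = 2 * real (Suc k) * (real (Suc n) * fact n)"
        "fact (Suc k) = real (Suc k) * fact k"
        using j 0 unfolding fact_Suc by simp_all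
      then show ?thesis using j 0 by (simp add: divide_simps del: of_nat_Suc fact_Suc)
    next
      case (Suc i)
      have e: "Suc (Suc n) - 2 * Suc k = Suc i" "Suc n - 2 * Suc k = i" "n - 2 * k = Suc i"
        "2 * Suc k \<le> Suc (Suc n)" "2 * Suc k \<le> Suc n" "2 * k \<le> n"
        using j Suc by auto
      have r: "real (Suc (Suc n)) = 2 * real (Suc k) + real (Suc i)" using j Suc by simp
      define F G y where "F = (fact n :: real)" and "G = (fact k * fact i :: real)" and "y = (2 * x) ^ i"
      define a b where "a = real (Suc k)" and "b = real (Suc i)"
      have pos: "a > 0" "b > 0" "G > 0" by (auto simp: a_def b_def G_def)
      have f: "(fact (Suc (Suc n)) :: real) = (2 * a + b) * (real (Suc n) * F)"
        "(fact (Suc n) :: real) = real (Suc n) * F"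
        unfolding fact_Suc r a_def b_def F_def by simp_all
      have g: "fact (Suc k) * fact (Suc i) = a * b * G" "fact (Suc k) * fact i = a * G"
        "fact k * fact (Suc i) = b * G"
        unfolding fact_Suc a_def b_def G_def by (simp_all del: of_nat_Suc)
      have "- ((- 1) ^ k) * ((2 * a + b) * (real (Suc n) * F)) / (a * b * G) * (2 * x * y) =
          2 * x * (- ((- 1) ^ k) * (real (Suc n) * F) / (a * G) * y)
          - 2 * real (Suc n) * ((- 1) ^ k * F / (b * G) * (2 * x * y))"
        using pos by (simp add: divide_simps del: of_nat_Suc) (simp add: algebra_simps del: of_nat_Suc)
      then show ?thesis
        using e(4-6) unfolding e(1-3) f g F_def[symmetric] power_Suc y_def[symmetric]
        by (simp del: of_nat_Suc fact_Suc)
    qed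
  next
    case False
    then show ?thesis by auto
  qed
  have "Hermite (Suc (Suc n)) x = (\<Sum>k\<le>Suc n. ?c (Suc (Suc n)) k)"
    by (intro Hermite_eq_sum) auto
  also have "\<dots> = ?c (Suc (Suc n)) 0 + (\<Sum>k\<le>n. ?c (Suc (Suc n)) (Suc k))"
    by (rule sum.atMost_Suc_shift)
  also have "\<dots> = 2 * x * (?c (Suc n) 0 + (\<Sum>k\<le>n. ?c (Suc n) (Suc k)))
      - 2 * real (Suc n) * (\<Sum>k\<le>n. ?c n k)"
    unfolding 0 S sum_subtractf sum_distrib_left distrib_left by simp
  also have "?c (Suc n) 0 + (\<Sum>k\<le>n. ?c (Suc n) (Suc k)) = (\<Sum>k\<le>Suc n. ?c (Suc n) k)"
    by (rule sum.atMost_Suc_shift[symmetric])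
  also have "\<dots> = Hermite (Suc n) x"
    by (intro Hermite_eq_sum[symmetric]) auto
  also have "(\<Sum>k\<le>n. ?c n k) = Hermite n x"
    by (intro Hermite_eq_sum[symmetric]) auto
  finally show ?thesis .
qed

lemma Hermite_minus: "Hermite n (- x) = (-1) ^ n * Hermite n x"
proof -
  have "(- (2 * x)) ^ (n - 2 * k) = (-1) ^ n * (2 * x) ^ (n - 2 * k)" if "k \<le> n div 2" for k
  proof -
    have "(-1 :: real) ^ (n - 2 * k) = (-1) ^ n"
      using that by (auto simp: minus_one_power_iff)
    then show ?thesis by (subst power_minus) simp
  qed
  then show ?thesis
    unfolding Hermite_def sum_distrib_left by (intro sum.cong) auto
qed

lemma Hermite_at_0_even: "Hermite (2 * m) 0 = (-1) ^ m * fact (2 * m) / fact m"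
proof -
  have "Hermite (2 * m) 0 = fact (2 * m) * (\<Sum>k\<in>{m}. (-1) ^ k / fact k)"
    unfolding Hermite_def
    by (intro arg_cong2[of _ _ _ _ "(*)"] refl sum.mono_neutral_cong_right) auto
  then show ?thesis by simp
qed

lemma Hermite_at_0_odd: "odd n \<Longrightarrow> Hermite n 0 = 0"
  using Hermite_minus[of n 0] by simp

text \<open>Hermite's equation H'' = 2x H' - 2n H, with H' written as 2n H_(n-1). Differentiating
  once more produces H_(n-2), which the recurrence eliminates; degrees 0 and 1 are separate because
  the recurrence does not reach them.\<close>

lemma Hermite_ode:
  "((\<lambda>x. 2 * real n * Hermite (n - 1) x) has_real_derivative
      2 * x * (2 * real n * Hermite (n - 1) x) - 2 * real n * Hermite n x) (at x)"
proof (cases "n \<le> 1")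
  case True
  then consider "n = 0" | "n = 1" by linarith
  then show ?thesis
  proof cases
    case 2
    have "Hermite 1 x = 2 * x" by (simp add: Hermite_def)
    then show ?thesis using 2 by simp
  qed simp
next
  case False
  then obtain l where n: "n = Suc (Suc l)"
    by (cases n; cases "n - 1") auto
  have "2 * real n * (2 * real (n - 1) * Hermite (n - 1 - 1) x) =
      2 * x * (2 * real n * Hermite (n - 1) x) - 2 * real n * Hermite n x"
    unfolding n Hermite_Suc_Suc by (simp add: algebra_simps)
  then show ?thesis
    using DERIV_cmult[OF has_real_derivative_Hermite[of "n - 1" x], of "2 * real n"] by simp
qed

section \<open>Stirling-type asymptotics\<close>

text \<open>Consecutive differences are 1 - (n + 1/2) ln(1 + 1/n) = O(1/n^2), hence summable, and
  they telescope. The limit (Stirling's constant) is left unidentified.\<close>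

lemma convergent_ln_fact_minus:
  "convergent (\<lambda>n. ln (fact n) - ((real n + 1 / 2) * ln (real n) - real n))"
proof -
  let ?d = "\<lambda>n. ln (fact n) - ((real n + 1 / 2) * ln (real n) - real n)"
  have "(\<lambda>n. 1 - (real n + 1 / 2) * ln (1 + 1 / real n)) \<in> O(\<lambda>n. 1 / real n ^ 2)"
    by real_asymp
  also have "?this \<longleftrightarrow> (\<lambda>n. ?d (Suc n) - ?d n) \<in> O(\<lambda>n. 1 / real n ^ 2)"
  proof (intro landau_o.big.in_cong eventually_mono[OF eventually_gt_at_top[of 0]])
    fix n :: nat
    assume "n > 0"
    then have "1 + 1 / real n = real (Suc n) / real n"
      by (simp add: field_simps)
    with \<open>n > 0\<close> have l: "ln (1 + 1 / real n) = ln (real (Suc n)) - ln (real n)"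
      by (simp add: ln_div del: of_nat_Suc)
    have f: "ln (fact (Suc n)) = ln (real (Suc n)) + ln (fact n)"
      unfolding fact_Suc by (subst ln_mult) auto
    show "1 - (real n + 1 / 2) * ln (1 + 1 / real n) = ?d (Suc n) - ?d n"
      unfolding l f by (simp add: algebra_simps del: fact_Suc)
  qed
  finally have "summable (\<lambda>n. ?d (Suc n) - ?d n)"
    by (rule summable_comparison_test_bigo[rotated])
      (use inverse_power_summable[of 2, where ?'a = real] in \<open>simp add: inverse_eq_divide\<close>)
  then have "convergent (\<lambda>n. ?d n - ?d 0)"
    unfolding summable_iff_convergent sum_lessThan_telescope[of ?d] .
  from convergent_add[OF this convergent_const[of "?d 0"]] show ?thesis by simp
qed

text \<open>The denominator is \<open>hermite_scale (2 * m)\<close>. Its factor sqrt 2 is the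
  quotient of the half powers (2m)^(1/2) and m^(1/2) in Stirling's formula.\<close>

lemma central_factorial_quotient_asymp:
  "(\<lambda>m. fact (2 * m) / fact m / (sqrt 2 * exp (real m * (ln (4 * real m) - 1)))) \<longlonglongrightarrow> 1"
proof -
  let ?d = "\<lambda>n. ln (fact n) - ((real n + 1 / 2) * ln (real n) - real n)"
  obtain L where L: "?d \<longlonglongrightarrow> L"
    using convergent_ln_fact_minus by (auto simp: convergent_def)
  have "(\<lambda>m. ?d (2 * m)) \<longlonglongrightarrow> L"
    by (rule filterlim_compose[OF L]) real_asymp
  from tendsto_exp[OF tendsto_diff[OF this L]]
  have "(\<lambda>m. exp (?d (2 * m) - ?d m)) \<longlonglongrightarrow> 1" by simp
  moreover have "eventually (\<lambda>m. exp (?d (2 * m) - ?d m) =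
      fact (2 * m) / fact m / (sqrt 2 * exp (real m * (ln (4 * real m) - 1)))) sequentially"
  proof (intro eventually_mono[OF eventually_gt_at_top[of 0]])
    fix m :: nat
    assume m: "m > 0"
    have "ln 4 = 2 * ln (2 :: real)" using ln_realpow[of 2 2] by simp
    then have d: "?d (2 * m) - ?d m =
        ln (fact (2 * m)) - ln (fact m) - (ln (sqrt 2) + real m * (ln (4 * real m) - 1))"
      using m by (simp add: ln_mult ln_sqrt algebra_simps)
    then show "exp (?d (2 * m) - ?d m) =
      fact (2 * m) / fact m / (sqrt 2 * exp (real m * (ln (4 * real m) - 1)))"
      unfolding d exp_diff exp_add by simp
  qed
  ultimately show ?thesis by (rule Lim_transform_eventually)
qed

section \<open>Behaviour at the origin\<close>

lemma tendsto_even_odd: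
  fixes f :: "nat \<Rightarrow> 'a :: topological_space"
  assumes "(\<lambda>m. f (2 * m)) \<longlonglongrightarrow> L" and "(\<lambda>m. f (2 * m + 1)) \<longlonglongrightarrow> L"
  shows "f \<longlonglongrightarrow> L"
proof (rule topological_tendstoI)
  fix S assume "open S" "L \<in> S"
  from topological_tendstoD[OF assms(1) this] topological_tendstoD[OF assms(2) this]
  obtain M N where M: "\<And>m. m \<ge> M \<Longrightarrow> f (2 * m) \<in> S" and N: "\<And>m. m \<ge> N \<Longrightarrow> f (2 * m + 1) \<in> S"
    by (auto simp: eventually_sequentially)
  show "eventually (\<lambda>n. f n \<in> S) sequentially"
  proof (rule eventually_sequentiallyI)
    fix n assume n: "2 * (M + N) + 1 \<le> n"
    show "f n \<in> S"
      using M[of "n div 2"] N[of "n div 2"] n by (cases "even n") (auto elim!: evenE oddE)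
  qed
qed

text \<open>This is \<open>amplitude5 n 0\<close>, the normalisation under which both initial values
  below become asymptotically trigonometric.\<close>

definition hermite_scale :: "nat \<Rightarrow> real" where
  "hermite_scale n = sqrt 2 * exp (real n / 2 * (ln (2 * real n) - 1))"

lemma hermite_scale_pos: "hermite_scale n > 0"
  by (simp add: hermite_scale_def)

lemma tendsto_sign_mult_diff:
  assumes "g \<longlonglongrightarrow> (1 :: real)"
  shows "(\<lambda>m. (-1) ^ m * g m - (-1) ^ m) \<longlonglongrightarrow> 0"
proof -
  have "(\<lambda>m. g m - 1) \<longlonglongrightarrow> 0" using tendsto_diff[OF assms tendsto_const[of 1]] by simp
  then have "(\<lambda>m. norm (g m - 1)) \<longlonglongrightarrow> 0" by (rule tendsto_norm_zero)
  moreover have "norm (g m - 1) = norm ((-1) ^ m * g m - (-1) ^ m)" for m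
  proof -
    have "(-1) ^ m * g m - (-1) ^ m = (-1) ^ m * (g m - 1)" by (simp add: algebra_simps)
    then show ?thesis by (simp add: abs_mult power_abs)
  qed
  ultimately show ?thesis by (simp add: tendsto_norm_zero_iff del: real_norm_def)
qed

lemma Hermite_at_0_asymp:
  "(\<lambda>n. Hermite n 0 / hermite_scale n - cos (real n * pi / 2)) \<longlonglongrightarrow> 0"
proof (rule tendsto_even_odd)
  have "Hermite (2 * m) 0 / hermite_scale (2 * m) - cos (real (2 * m) * pi / 2) =
      (-1) ^ m * (fact (2 * m) / fact m / (sqrt 2 * exp (real m * (ln (4 * real m) - 1)))) - (-1) ^ m" for m
    by (simp add: Hermite_at_0_even hermite_scale_def)
  then show "(\<lambda>m. Hermite (2 * m) 0 / hermite_scale (2 * m) - cos (real (2 * m) * pi / 2)) \<longlonglongrightarrow> 0"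
    using tendsto_sign_mult_diff[OF central_factorial_quotient_asymp] by (simp only:)
next
  have "cos (real (2 * m + 1) * pi / 2) = 0" for m
  proof -
    have arg: "real (2 * m + 1) * pi / 2 = real m * pi + pi / 2" by (simp add: field_simps)
    show ?thesis unfolding arg by (simp add: cos_add)
  qed
  then show "(\<lambda>m. Hermite (2 * m + 1) 0 / hermite_scale (2 * m + 1)
      - cos (real (2 * m + 1) * pi / 2)) \<longlonglongrightarrow> 0"
    by (simp add: Hermite_at_0_odd)
qed

text \<open>The first term is the t-derivative of H_n(sqrt(2n) t) at t = 0, divided by 2n and by the
  scale: the initial slope in the units of the energy estimate.\<close>

lemma Hermite_pred_at_0_asymp:
  "(\<lambda>n. sqrt (2 * real n) * Hermite (n - 1) 0 / hermite_scale n - sin (real n * pi / 2)) \<longlonglongrightarrow> 0"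
proof (rule tendsto_even_odd)
  have "sqrt (2 * real (2 * m)) * Hermite (2 * m - 1) 0 / hermite_scale (2 * m)
      - sin (real (2 * m) * pi / 2) = 0" for m
  proof -
    have arg: "real (2 * m) * pi / 2 = real m * pi" by simp
    have "sqrt (2 * real (2 * m)) * Hermite (2 * m - 1) 0 = 0"
      by (cases m) (auto simp: Hermite_at_0_odd)
    then show ?thesis unfolding arg by simp
  qed
  then show "(\<lambda>m. sqrt (2 * real (2 * m)) * Hermite (2 * m - 1) 0 / hermite_scale (2 * m)
      - sin (real (2 * m) * pi / 2)) \<longlonglongrightarrow> 0"
    by (simp only: tendsto_const)
next
  let ?g = "\<lambda>m. fact (2 * m) / fact m / (sqrt 2 * exp (real m * (ln (4 * real m) - 1)))"
  \<comment> \<open>\<open>?h\<close> passes from the normalisation of degree 2m to that of degree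
    2m + 1. Its logarithm is 1/2 - m ln(1 + 1/(2m)), which tends to 0.\<close>
  let ?h = "\<lambda>m. sqrt (4 * real m + 2) * exp (real m * (ln (4 * real m) - 1))
      / exp ((real m + 1 / 2) * (ln (4 * real m + 2) - 1))"
  have e: "1 / 2 + (ln 4 - 1) / 2 = ln (2 :: real)"
    using ln_realpow[of 2 2] by (simp add: field_simps)
  have "?h \<longlonglongrightarrow> 1" by real_asymp (simp add: e)
  from tendsto_mult[OF central_factorial_quotient_asymp this]
  have "(\<lambda>m. ?g m * ?h m) \<longlonglongrightarrow> 1" by simp
  moreover have "sqrt (2 * real (2 * m + 1)) * Hermite (2 * m + 1 - 1) 0 / hermite_scale (2 * m + 1)
      - sin (real (2 * m + 1) * pi / 2) = (-1) ^ m * (?g m * ?h m) - (-1) ^ m" for m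
  proof -
    have arg: "real (2 * m + 1) * pi / 2 = real m * pi + pi / 2" by (simp add: field_simps)
    have sn: "sin (real (2 * m + 1) * pi / 2) = (-1) ^ m" unfolding arg by (simp add: sin_add)
    have nn: "real (2 * m + 1) / 2 = real m + 1 / 2" "2 * real (2 * m + 1) = 4 * real m + 2"
      by simp_all
    have gen: "s * (t * F / G) / (k * E2) = t * (F / G / (k * E1) * (s * E1 / E2))"
      if "E1 \<noteq> 0" for s t F G k E1 E2 :: real
      using that by (simp add: field_simps)
    show ?thesis
      unfolding hermite_scale_def add_diff_cancel_right' Hermite_at_0_even sn nn
      by (intro arg_cong2[where f = "(-)"] gen exp_not_eq_zero refl)
  qed
  ultimately show "(\<lambda>m. sqrt (2 * real (2 * m + 1)) * Hermite (2 * m + 1 - 1) 0 / hermite_scale (2 * m + 1)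
      - sin (real (2 * m + 1) * pi / 2)) \<longlonglongrightarrow> 0"
    using tendsto_sign_mult_diff by (simp only:)
qed

section \<open>The WKB approximation and the energy estimate\<close>

text \<open>A Gronwall argument. With E = w'^2 + Q w^2 and Q = N^2 (1 - t^2) + N, the equation gives
  E' = -2 w' e + Q' w^2, where Q' <= 0 for t >= 0; hence E' <= E + K^2, and exp(-t) (E + K^2) is
  nonincreasing. The bound s <= 1 keeps Q nonnegative.\<close>

lemma oscillator_energy_bound:
  fixes w w' e :: "real \<Rightarrow> real"
  assumes "0 \<le> N" and s: "0 \<le> s"
    and w: "\<And>t. 0 \<le> t \<Longrightarrow> t \<le> s \<Longrightarrow> (w has_real_derivative w' t) (at t)"
    and w': "\<And>t. 0 \<le> t \<Longrightarrow> t \<le> s \<Longrightarrow>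
      (w' has_real_derivative - (N\<^sup>2 * (1 - t\<^sup>2) + N) * w t - e t) (at t)"
    and e: "\<And>t. 0 \<le> t \<Longrightarrow> t \<le> s \<Longrightarrow> \<bar>e t\<bar> \<le> K"
    and "s \<le> 1"
  shows "(w' s)\<^sup>2 + (N\<^sup>2 * (1 - s\<^sup>2) + N) * (w s)\<^sup>2 + K\<^sup>2
    \<le> exp s * ((w' 0)\<^sup>2 + (N\<^sup>2 + N) * (w 0)\<^sup>2 + K\<^sup>2)"
proof -
  define E where "E t = (w' t)\<^sup>2 + (N\<^sup>2 * (1 - t\<^sup>2) + N) * (w t)\<^sup>2" for t
  have "exp (- s) * (E s + K\<^sup>2) \<le> exp (- 0) * (E 0 + K\<^sup>2)"
  proof (rule DERIV_nonpos_imp_nonincreasing[OF s])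
    fix t assume t: "0 \<le> t" "t \<le> s"
    let ?E' = "- 2 * w' t * e t - 2 * N\<^sup>2 * t * (w t)\<^sup>2"
    have "(E has_real_derivative ?E') (at t)"
      unfolding E_def
      by (rule derivative_eq_intros w[OF t] w'[OF t] refl)+ (simp add: algebra_simps power2_eq_square)
    then have "((\<lambda>t. exp (- t) * (E t + K\<^sup>2)) has_real_derivative
        exp (- t) * (?E' - (E t + K\<^sup>2))) (at t)"
      by (auto intro!: derivative_eq_intros simp: algebra_simps)
    moreover have "exp (- t) * (?E' - (E t + K\<^sup>2)) \<le> 0"
    proof -
      have "(e t)\<^sup>2 \<le> K\<^sup>2" using e[OF t] by (metis abs_ge_zero power2_abs power_mono)
      \<comment> \<open>Expanding this square yields -2 w' e <= w'^2 + e^2.\<close>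
      moreover have "0 \<le> (w' t + e t)\<^sup>2" by simp
      moreover have "0 \<le> N\<^sup>2 * t * (w t)\<^sup>2" using t by simp
      moreover have "0 \<le> (N\<^sup>2 * (1 - t\<^sup>2) + N) * (w t)\<^sup>2"
      proof -
        have "t\<^sup>2 \<le> 1" using t assms by (simp add: power_le_one)
        then show ?thesis using assms by simp
      qed
      ultimately have "?E' - (E t + K\<^sup>2) \<le> 0"
        unfolding E_def by (simp add: power2_sum algebra_simps)
      then show ?thesis by (simp add: mult_nonneg_nonpos)
    qed
    ultimately show "\<exists>y. ((\<lambda>t. exp (- t) * (E t + K\<^sup>2)) has_real_derivative y) (at t) \<and> y \<le> 0"
      by blast
  qed
  then have "E s + K\<^sup>2 \<le> exp s * (E 0 + K\<^sup>2)"
    by (simp add: exp_minus field_simps)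
  then show ?thesis by (simp add: E_def)
qed

text \<open>Antiderivative of N q + 1/(2q), q = sqrt(1 - t^2): the first two terms of sqrt(N^2 q^2 +
  N) for large N. Its square is N^2 q^2 + N + 1/(4 q^2), so it misses the coefficient only by a term
  free of N.\<close>

definition wkb_phase :: "real \<Rightarrow> real \<Rightarrow> real" where
  "wkb_phase N t = N / 2 * (t * sqrt (1 - t\<^sup>2) + arcsin t) + arcsin t / 2"

text \<open>The Liouville-Green amplitude q^(-1/2), i.e. (phase')^(-1/2) to leading order, scaled to
  be 1 at the origin.\<close>

definition wkb_amplitude :: "real \<Rightarrow> real" where
  "wkb_amplitude t = (1 - t\<^sup>2) powr (- 1 / 4)"

lemma has_real_derivative_sqrt_one_minus_square:
  assumes "\<bar>t\<bar> < (1 :: real)"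
  shows "((\<lambda>t. sqrt (1 - t\<^sup>2)) has_real_derivative - t / sqrt (1 - t\<^sup>2)) (at t)"
proof -
  have "1 - t\<^sup>2 > 0" using assms by (simp add: abs_square_less_1)
  then show ?thesis by (auto intro!: derivative_eq_intros simp: field_simps)
qed

lemma has_real_derivative_wkb_phase:
  assumes "\<bar>t\<bar> < 1"
  shows "(wkb_phase N has_real_derivative N * sqrt (1 - t\<^sup>2) + 1 / (2 * sqrt (1 - t\<^sup>2))) (at t)"
proof -
  define q where "q = sqrt (1 - t\<^sup>2)"
  have p: "1 - t\<^sup>2 > 0" using assms by (simp add: abs_square_less_1)
  then have q: "q > 0" "t\<^sup>2 = 1 - q\<^sup>2" by (auto simp: q_def)
  have "(arcsin has_real_derivative 1 / q) (at t)"
    using DERIV_arcsin[of t] assms by (simp add: q_def inverse_eq_divide)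
  then have "((\<lambda>t. wkb_phase N t) has_real_derivative
      N / 2 * ((1 * sqrt (1 - t\<^sup>2) + - t / q * t) + 1 / q) + 1 / q / 2) (at t)"
    unfolding wkb_phase_def
    using has_real_derivative_sqrt_one_minus_square[OF assms, folded q_def]
    by (intro DERIV_add DERIV_cmult DERIV_cdivide DERIV_mult DERIV_ident)
  moreover have "(1 * sqrt (1 - t\<^sup>2) + - t / q * t) + 1 / q = 2 * q"
    unfolding q_def[symmetric] using q by (simp add: field_simps power2_eq_square)
  ultimately have "(wkb_phase N has_real_derivative N / 2 * (2 * q) + 1 / q / 2) (at t)"
    by (simp only:)
  then show ?thesis unfolding q_def by (simp add: mult.commute)
qed

text \<open>Mean value inequality: the difference has derivative N(q - 1) + 1/(2q), where 1 - q <=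
  t^2 and q >= 1/2 on the interval. For t = xi/sqrt N the factor N t^2 is just xi^2, so the error is
  O(|t|) for bounded xi.\<close>

lemma wkb_phase_near_0:
  assumes t: "\<bar>t\<bar> \<le> 1 / 2" and "0 \<le> N"
  shows "\<bar>wkb_phase N t - N * t\<bar> \<le> (N * t\<^sup>2 + 1) * \<bar>t\<bar>"
proof -
  let ?f = "\<lambda>t. wkb_phase N t - N * t"
  have "norm (?f t - ?f 0) \<le> (N * t\<^sup>2 + 1) * norm (t - 0)"
  proof (rule field_differentiable_bound[of "cball 0 \<bar>t\<bar>" ?f])
    fix z :: real assume "z \<in> cball 0 \<bar>t\<bar>"
    then have z: "\<bar>z\<bar> \<le> \<bar>t\<bar>" by simp
    with t have z1: "\<bar>z\<bar> < 1" by linarith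
    from z have z2: "z\<^sup>2 \<le> t\<^sup>2" by (simp add: abs_le_square_iff)
    have "t\<^sup>2 \<le> (1 / 2)\<^sup>2" using t by (metis abs_ge_zero power2_abs power_mono)
    then have p: "1 / 2 \<le> 1 - z\<^sup>2" "1 - z\<^sup>2 \<le> 1" using z2 by (auto simp: power2_eq_square)
    let ?q = "sqrt (1 - z\<^sup>2)"
    have q: "1 - z\<^sup>2 \<le> ?q" "?q \<le> 1"
      using p by (auto intro!: real_le_rsqrt simp: power2_eq_square mult_left_le)
    show "(?f has_real_derivative N * ?q + 1 / (2 * ?q) - N) (at z within cball 0 \<bar>t\<bar>)"
      using DERIV_diff[OF has_real_derivative_wkb_phase[OF z1, of N] DERIV_cmult[OF DERIV_ident, of N]]
      unfolding mult_1_right by (rule has_field_derivative_at_within)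
    have "1 / 2 \<le> ?q" using p q by linarith
    moreover have "0 \<le> 1 / (2 * x) \<and> 1 / (2 * x) \<le> 1" if "1 / 2 \<le> x" for x :: real
      using that by (simp add: field_simps)
    ultimately have "0 \<le> 1 / (2 * ?q)" "1 / (2 * ?q) \<le> 1" by blast+
    moreover have "N * (1 - ?q) \<le> N * t\<^sup>2" using assms q z2 by (intro mult_left_mono) auto
    moreover have "0 \<le> N * (1 - ?q)" using assms q by simp
    ultimately show "norm (N * ?q + 1 / (2 * ?q) - N) \<le> N * t\<^sup>2 + 1"
      unfolding real_norm_def abs_le_iff right_diff_distrib by linarith
  qed auto
  then show ?thesis by (simp add: wkb_phase_def)
qed

text \<open>With q = sqrt(1 - t^2), B' = B t/(2 q^2) and the phase derivative is N q + 1/(2q). Every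
  derivative thus keeps B as a factor, and the second statement reduces to comparing the
  coefficients of cos and sin.\<close>

lemma has_real_derivative_wkb:
  fixes N c :: real
  defines "B \<equiv> wkb_amplitude" and "\<Phi> \<equiv> \<lambda>t. wkb_phase N t - c"
  assumes t: "\<bar>t\<bar> < 1"
  shows "((\<lambda>t. B t * cos (\<Phi> t)) has_real_derivative
      B t * (t / (2 * (1 - t\<^sup>2)) * cos (\<Phi> t)
        - (N * sqrt (1 - t\<^sup>2) + 1 / (2 * sqrt (1 - t\<^sup>2))) * sin (\<Phi> t))) (at t)"
    (is ?d1)
    and "((\<lambda>t. B t * (t / (2 * (1 - t\<^sup>2)) * cos (\<Phi> t)
        - (N * sqrt (1 - t\<^sup>2) + 1 / (2 * sqrt (1 - t\<^sup>2))) * sin (\<Phi> t))) has_real_derivative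
      - (N\<^sup>2 * (1 - t\<^sup>2) + N) * (B t * cos (\<Phi> t))
      + B t * ((1 / (4 * (1 - t\<^sup>2)) + 5 * t\<^sup>2 / (4 * (1 - t\<^sup>2)\<^sup>2)) * cos (\<Phi> t)
         - t / ((1 - t\<^sup>2) * sqrt (1 - t\<^sup>2)) * sin (\<Phi> t))) (at t)"
    (is ?d2)
proof -
  define p where "p = 1 - t\<^sup>2"
  define q where "q = sqrt p"
  have p: "p > 0" using t by (simp add: p_def abs_square_less_1)
  have q: "q > 0" "p = q\<^sup>2" "t\<^sup>2 = 1 - q\<^sup>2" "1 - t\<^sup>2 = q\<^sup>2" "sqrt (1 - t\<^sup>2) = q"
    using p by (auto simp: q_def p_def)
  have qq: "sqrt (q\<^sup>2) = q" using q(1) by simp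
  have B: "(B has_real_derivative B t * (t / (2 * q\<^sup>2))) (at t)"
  proof -
    have "((\<lambda>t. wkb_amplitude t) has_real_derivative
        (- 1 / 4) * p powr (- 1 / 4 - 1) * (- 2 * t)) (at t)"
      unfolding wkb_amplitude_def p_def using p p_def by (auto intro!: derivative_eq_intros)
    moreover have "p powr (- 1 / 4 - 1) = B t / q\<^sup>2"
      unfolding B_def wkb_amplitude_def powr_diff p_def[symmetric] using p q by simp
    ultimately show ?thesis by (simp add: B_def field_simps)
  qed
  have s: "((\<lambda>t. sqrt (1 - t\<^sup>2)) has_real_derivative - t / q) (at t)"
    using has_real_derivative_sqrt_one_minus_square[OF t] by (simp only: q(5))
  have F: "(\<Phi> has_real_derivative N * q + 1 / (2 * q)) (at t)"
    unfolding \<Phi>_def using has_real_derivative_wkb_phase[OF t, of N]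
    by (auto intro!: derivative_eq_intros simp: q(5))
  have d1: "((\<lambda>t. B t * cos (\<Phi> t)) has_real_derivative
      B t * (t / (2 * q\<^sup>2) * cos (\<Phi> t) - (N * q + 1 / (2 * q)) * sin (\<Phi> t))) (at t)"
    by (rule derivative_eq_intros B F refl)+ (simp add: algebra_simps)
  then show ?d1 by (simp only: q(4) qq)
  have T1: "((\<lambda>t. t / (2 * (1 - t\<^sup>2))) has_real_derivative 1 / (2 * q\<^sup>2) + t\<^sup>2 / q ^ 4) (at t)"
  proof -
    have "((\<lambda>t. t / (2 * (1 - t\<^sup>2))) has_real_derivative
        (1 * (2 * q\<^sup>2) - t * (- 4 * t)) / ((2 * q\<^sup>2) * (2 * q\<^sup>2))) (at t)"
      unfolding q(4)[symmetric] using q(1,4)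
      by (intro DERIV_divide) (auto intro!: derivative_eq_intros)
    moreover have "(1 * (2 * q\<^sup>2) - t * (- 4 * t)) / ((2 * q\<^sup>2) * (2 * q\<^sup>2)) = 1 / (2 * q\<^sup>2) + t\<^sup>2 / q ^ 4"
      using q(1) by (simp add: field_simps eval_nat_numeral)
    ultimately show ?thesis by (simp only:)
  qed
  have T2: "((\<lambda>t. N * sqrt (1 - t\<^sup>2) + 1 / (2 * sqrt (1 - t\<^sup>2))) has_real_derivative
      - N * t / q + t / (2 * q ^ 3)) (at t)"
  proof -
    have "((\<lambda>t. N * sqrt (1 - t\<^sup>2) + 1 / (2 * sqrt (1 - t\<^sup>2))) has_real_derivative
        N * (- t / q) + (0 * (2 * q) - 1 * (2 * (- t / q))) / ((2 * q) * (2 * q))) (at t)"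
      unfolding q(5)[symmetric] using q(1,5)
      by (intro DERIV_add DERIV_divide DERIV_cmult DERIV_const) (use s in auto)
    moreover have "N * (- t / q) + (0 * (2 * q) - 1 * (2 * (- t / q))) / ((2 * q) * (2 * q)) =
        - N * t / q + t / (2 * q ^ 3)"
      using q(1) by (simp add: field_simps eval_nat_numeral)
    ultimately show ?thesis by (simp only:)
  qed
  let ?a = "t / (2 * q\<^sup>2)" and ?b = "N * q + 1 / (2 * q)"
    and ?a' = "1 / (2 * q\<^sup>2) + t\<^sup>2 / q ^ 4" and ?b' = "- N * t / q + t / (2 * q ^ 3)"
  have gen: "((\<lambda>t. B t * (f t * cos (\<Phi> t) - g t * sin (\<Phi> t))) has_real_derivative
      B t * (?a * (f t * cos (\<Phi> t) - g t * sin (\<Phi> t))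
        + (f' * cos (\<Phi> t) - f t * ?b * sin (\<Phi> t) - g' * sin (\<Phi> t) - g t * ?b * cos (\<Phi> t)))) (at t)"
    if "(f has_real_derivative f') (at t)" "(g has_real_derivative g') (at t)" for f g f' g'
    by (rule derivative_eq_intros B F that refl)+
      (simp add: algebra_simps add_divide_distrib diff_divide_distrib)
  have "((\<lambda>t. B t * (t / (2 * (1 - t\<^sup>2)) * cos (\<Phi> t)
        - (N * sqrt (1 - t\<^sup>2) + 1 / (2 * sqrt (1 - t\<^sup>2))) * sin (\<Phi> t))) has_real_derivative
      B t * (?a * (?a * cos (\<Phi> t) - ?b * sin (\<Phi> t))
        + (?a' * cos (\<Phi> t) - ?a * ?b * sin (\<Phi> t) - ?b' * sin (\<Phi> t) - ?b * ?b * cos (\<Phi> t)))) (at t)"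
    using gen[OF T1 T2] by (simp only: q(4) qq)
  moreover have "?a * (?a * C - ?b * S) + (?a' * C - ?a * ?b * S - ?b' * S - ?b * ?b * C) =
      - (N\<^sup>2 * q\<^sup>2 + N) * C
      + ((1 / (4 * q\<^sup>2) + 5 * t\<^sup>2 / (4 * (q\<^sup>2)\<^sup>2)) * C - t / (q\<^sup>2 * q) * S)" for C S
  proof -
    \<comment> \<open>The cross term of (N q + 1/(2q))^2 is exactly N, which matches the coefficient
      of the equation.\<close>
    have id1: "?a * ?a + ?a' - ?b * ?b = - (N\<^sup>2 * q\<^sup>2 + N) + (1 / (4 * q\<^sup>2) + 5 * t\<^sup>2 / (4 * (q\<^sup>2)\<^sup>2))"
      using q(1) by (simp add: field_simps eval_nat_numeral)
    \<comment> \<open>The terms +N t/q and -N t/q cancel here; this is what the exponent -1/4 of the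
      amplitude achieves.\<close>
    have id2: "?a * ?b + ?a * ?b + ?b' = t / (q\<^sup>2 * q)"
      using q(1) by (simp add: field_simps eval_nat_numeral)
    have lin: "a * (a * C - b * S) + (a' * C - a * b * S - b' * S - b * b * C) =
        (a * a + a' - b * b) * C - (a * b + a * b + b') * S" for a b a' b' :: real
      by (simp add: algebra_simps)
    show ?thesis unfolding lin unfolding id1 id2 by (simp only: distrib_right add_diff_eq)
  qed
  then have "B t * (?a * (?a * C - ?b * S) + (?a' * C - ?a * ?b * S - ?b' * S - ?b * ?b * C)) =
      - (N\<^sup>2 * q\<^sup>2 + N) * (B t * C)
      + B t * ((1 / (4 * q\<^sup>2) + 5 * t\<^sup>2 / (4 * (q\<^sup>2)\<^sup>2)) * C - t / (q\<^sup>2 * q) * S)" for C S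
    by (simp only: distrib_left mult.left_commute)
  ultimately show ?d2 by (simp only: q(4) qq)
qed

section \<open>The saddle-point functions in trigonometric form\<close>

text \<open>The radicand is minus a square, so both roots are purely imaginary; \<open>csqrt\<close>
  takes the one with nonnegative imaginary part, and cos theta > 0 fixes the sign.\<close>

lemma sigma_sin:
  assumes "- pi / 2 < \<theta>" "\<theta> < pi / 2"
  shows "sigma n (sqrt (2 * real n) * sin \<theta>) = \<i> * of_real (sqrt (2 * real n) * cos \<theta>)"
proof -
  have "cos \<theta> > 0" using assms by (intro cos_gt_zero_pi) auto
  have "(sqrt (2 * real n) * sin \<theta>)\<^sup>2 - 2 * real n = - (sqrt (2 * real n) * cos \<theta>)\<^sup>2"
    by (simp add: power_mult_distrib sin_squared_eq algebra_simps)
  then show ?thesis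
    unfolding sigma_def using \<open>cos \<theta> > 0\<close>
    by (intro csqrt_unique) (auto simp: power_mult_distrib simp flip: of_real_power)
qed

text \<open>1 + i tan theta = cis theta / cos theta, and cis(theta/2) lies in the right half plane
  because |theta/2| < pi/4, so halving the angle gives the principal root.\<close>

lemma csqrt_half_one_plus_tan:
  assumes "- pi / 2 < \<theta>" "\<theta> < pi / 2"
  shows "csqrt (1 / 2 * (1 + \<i> * of_real (tan \<theta>))) = cis (\<theta> / 2) / of_real (sqrt (2 * cos \<theta>))"
proof (rule csqrt_unique)
  have c: "cos \<theta> > 0" using assms by (intro cos_gt_zero_pi) auto
  have "(cis (\<theta> / 2) / of_real (sqrt (2 * cos \<theta>)))\<^sup>2 = cis \<theta> / of_real (2 * cos \<theta>)"
    using c by (simp add: power_divide Complex.DeMoivre flip: of_real_power)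
  also have "\<dots> = 1 / 2 * (1 + \<i> * of_real (tan \<theta>))"
    using c by (simp add: complex_eq_iff tan_def)
  finally show "(cis (\<theta> / 2) / of_real (sqrt (2 * cos \<theta>)))\<^sup>2 = 1 / 2 * (1 + \<i> * of_real (tan \<theta>))" .
  have "cos (\<theta> / 2) > 0" using assms by (intro cos_gt_zero_pi) auto
  then show "0 < Re (cis (\<theta> / 2) / of_real (sqrt (2 * cos \<theta>))) \<or>
      Re (cis (\<theta> / 2) / of_real (sqrt (2 * cos \<theta>))) = 0 \<and>
      0 \<le> Im (cis (\<theta> / 2) / of_real (sqrt (2 * cos \<theta>)))"
    using c by simp
qed

lemma exp_of_real_plus_i: "exp (of_real a + \<i> * of_real b) = of_real (exp a) * cis b"
  by (simp add: exp_add cis_conv_exp exp_of_real)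

text \<open>For r = sqrt(2n), sigma - xi and sigma + xi are r cis(pi/2 + theta) and r cis(pi/2 -
  theta). Both angles lie in (0, pi), so the principal logarithms are read off directly, and
  xi/sigma = -i tan theta.\<close>

lemma
  assumes n: "1 \<le> n" and \<theta>: "- pi / 2 < \<theta>" "\<theta> < pi / 2"
  defines "A \<equiv> exp (real n / 2 * (ln (2 * real n) - cos (2 * \<theta>))) / sqrt (2 * cos \<theta>)"
  shows Lambda1_sin: "Lambda1 n (sqrt (2 * real n) * sin \<theta>) = of_real A * cis (Theta n \<theta>)"
    and Lambda2_sin: "Lambda2 n (sqrt (2 * real n) * sin \<theta>) = of_real A * cis (- Theta n \<theta>)"
proof -
  define r where "r = sqrt (2 * real n)"
  have r: "r > 0" "r\<^sup>2 = 2 * real n" "ln r = ln (2 * real n) / 2"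
    using n by (auto simp: r_def ln_sqrt)
  have c: "cos \<theta> > 0" using \<theta> by (intro cos_gt_zero_pi) auto
  have sig: "sigma n (r * sin \<theta>) = \<i> * of_real (r * cos \<theta>)"
    unfolding r_def by (rule sigma_sin[OF \<theta>])
  have quot: "of_real (r * sin \<theta>) / (\<i> * of_real (r * cos \<theta>)) = - (\<i> * of_real (tan \<theta>) :: complex)"
    using r c by (simp add: tan_def field_simps)
  have ln1: "ln (sigma n (r * sin \<theta>) - of_real (r * sin \<theta>)) =
      of_real (ln (2 * real n) / 2) + \<i> * of_real (\<theta> + pi / 2)"
  proof (rule Ln_unique)
    show "exp (of_real (ln (2 * real n) / 2) + \<i> * of_real (\<theta> + pi / 2)) =
        sigma n (r * sin \<theta>) - complex_of_real (r * sin \<theta>)"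
      unfolding exp_of_real_plus_i r(3)[symmetric] sig using r(1)
      by (simp add: complex_eq_iff cos_add sin_add)
  qed (use \<theta> in auto)
  have ln2: "ln (sigma n (r * sin \<theta>) + of_real (r * sin \<theta>)) =
      of_real (ln (2 * real n) / 2) + \<i> * of_real (pi / 2 - \<theta>)"
  proof (rule Ln_unique)
    show "exp (of_real (ln (2 * real n) / 2) + \<i> * of_real (pi / 2 - \<theta>)) =
        sigma n (r * sin \<theta>) + complex_of_real (r * sin \<theta>)"
      unfolding exp_of_real_plus_i r(3)[symmetric] sig using r(1)
      by (simp add: complex_eq_iff cos_diff sin_diff)
  qed (use \<theta> in auto)
  have x2: "(r * sin \<theta>)\<^sup>2 = real n * (1 - cos (2 * \<theta>))"
    using r(2) by (simp add: power_mult_distrib cos_double_sin)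
  have sx: "(r * cos \<theta>) * (r * sin \<theta>) = real n * sin (2 * \<theta>)"
  proof -
    have "(r * cos \<theta>) * (r * sin \<theta>) = r\<^sup>2 * (sin \<theta> * cos \<theta>)"
      by (simp add: power2_eq_square)
    also have "\<dots> = real n * sin (2 * \<theta>)"
      unfolding r(2) sin_double by simp
    finally show ?thesis .
  qed
  have x2c: "(complex_of_real (r * sin \<theta>))\<^sup>2 = of_real (real n * (1 - cos (2 * \<theta>)))"
    unfolding x2[symmetric] by simp
  have sxc: "\<i> * of_real (r * cos \<theta>) * of_real (r * sin \<theta>) = \<i> * of_real (real n * sin (2 * \<theta>))"
    unfolding sx[symmetric] of_real_mult by (simp only: mult_ac)
  have e1: "of_nat n * (of_real (ln (2 * real n) / 2) + \<i> * of_real (\<theta> + pi / 2))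
      + ((of_real (r * sin \<theta>))\<^sup>2 + \<i> * of_real (r * cos \<theta>) * of_real (r * sin \<theta>) - of_nat n) / 2
    = of_real (real n / 2 * (ln (2 * real n) - cos (2 * \<theta>)))
      + \<i> * complex_of_real (real n * (\<theta> + pi / 2 + sin (2 * \<theta>) / 2))"
    unfolding x2c sxc
    by (simp add: complex_eq_iff field_simps)
  \<comment> \<open>Writing the sign as cis(-n pi) turns n(theta + pi/2) into n(theta - pi/2),
    giving \<open>Theta\<close> itself and not merely its value modulo 2 pi.\<close>
  have sgn: "(-1) ^ n = cis (- (real n * pi))"
    by (simp add: DeMoivre2 complex_eq_iff flip: Complex.DeMoivre)
  have "Lambda1 n (r * sin \<theta>) = cis (- (real n * pi))
      * (of_real (exp (real n / 2 * (ln (2 * real n) - cos (2 * \<theta>))))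
          * cis (real n * (\<theta> + pi / 2 + sin (2 * \<theta>) / 2)))
      * (cis (\<theta> / 2) / of_real (sqrt (2 * cos \<theta>)))"
    unfolding Lambda1_def ln1 unfolding sig quot e1 exp_of_real_plus_i sgn
    using csqrt_half_one_plus_tan[OF \<theta>] by simp
  also have "\<dots> = of_real A * (cis (- (real n * pi))
      * cis (real n * (\<theta> + pi / 2 + sin (2 * \<theta>) / 2)) * cis (\<theta> / 2))"
    by (simp add: A_def)
  also have "\<dots> = of_real A * cis (Theta n \<theta>)"
    unfolding cis_mult Theta_def by (simp add: algebra_simps)
  finally show "Lambda1 n (sqrt (2 * real n) * sin \<theta>) = of_real A * cis (Theta n \<theta>)"
    unfolding r_def .
  have e2: "of_nat n * (of_real (ln (2 * real n) / 2) + \<i> * of_real (pi / 2 - \<theta>))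
      + ((of_real (r * sin \<theta>))\<^sup>2 - \<i> * of_real (r * cos \<theta>) * of_real (r * sin \<theta>) - of_nat n) / 2
    = of_real (real n / 2 * (ln (2 * real n) - cos (2 * \<theta>)))
      + \<i> * complex_of_real (real n * (pi / 2 - \<theta> - sin (2 * \<theta>) / 2))"
    unfolding x2c sxc
    by (simp add: complex_eq_iff field_simps)
  have "Lambda2 n (r * sin \<theta>) =
      (of_real (exp (real n / 2 * (ln (2 * real n) - cos (2 * \<theta>))))
          * cis (real n * (pi / 2 - \<theta> - sin (2 * \<theta>) / 2)))
      * (cis (- \<theta> / 2) / of_real (sqrt (2 * cos \<theta>)))"
    unfolding Lambda2_def ln2 unfolding sig quot e2 exp_of_real_plus_i
    using csqrt_half_one_plus_tan[of "- \<theta>"] \<theta> by simp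
  also have "\<dots> = of_real A * (cis (real n * (pi / 2 - \<theta> - sin (2 * \<theta>) / 2)) * cis (- \<theta> / 2))"
    by (simp add: A_def)
  also have "\<dots> = of_real A * cis (- Theta n \<theta>)"
    unfolding cis_mult Theta_def by (simp add: algebra_simps)
  finally show "Lambda2 n (sqrt (2 * real n) * sin \<theta>) = of_real A * cis (- Theta n \<theta>)"
    unfolding r_def .
qed

lemma Lambda5_sin:
  assumes "1 \<le> n" and \<theta>: "- pi / 2 < \<theta>" "\<theta> < pi / 2"
  shows "Lambda5 n (sqrt (2 * real n) * sin \<theta>) =
    of_real (sqrt (2 / cos \<theta>) * exp (real n / 2 * (ln (2 * real n) - cos (2 * \<theta>)))
      * cos (Theta n \<theta>))"
proof -
  have c: "cos \<theta> > 0" using \<theta> by (intro cos_gt_zero_pi) auto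
  have "sqrt (2 / cos \<theta>) = 2 / sqrt (2 * cos \<theta>)"
    using c by (simp add: real_sqrt_divide real_sqrt_mult field_simps)
  then show ?thesis
    unfolding Lambda5_def Lambda1_sin[OF assms] Lambda2_sin[OF assms]
    by (simp add: complex_eq_iff)
qed

lemma Lambda5_eq:
  assumes n: "1 \<le> n" and "\<bar>\<xi>\<bar> < sqrt (2 * real n)"
  shows "Lambda5 n \<xi> = of_real (amplitude5 n \<xi> * cos (phase5 n \<xi>))"
proof -
  define r where "r = sqrt (2 * real n)"
  have r: "r > 0" "r\<^sup>2 = 2 * real n" using n by (auto simp: r_def)
  define \<theta> where "\<theta> = arcsin (\<xi> / r)"
  have x: "\<bar>\<xi> / r\<bar> < 1" using assms r by (simp add: r_def)
  then have x': "- 1 < \<xi> / r" "\<xi> / r < 1" by linarith+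
  then have \<theta>: "- pi / 2 < \<theta>" "\<theta> < pi / 2"
    using arcsin_lt_bounded[of "\<xi> / r"] unfolding \<theta>_def by auto
  have \<xi>: "\<xi> = r * sin \<theta>"
    unfolding \<theta>_def using x' r by (subst sin_arcsin) auto
  have c: "cos \<theta> > 0" using \<theta> by (intro cos_gt_zero_pi) auto
  have x2: "\<xi>\<^sup>2 = real n * (1 - cos (2 * \<theta>))"
    using r(2) by (simp add: \<xi> power_mult_distrib cos_double_sin)
  have c2: "1 - \<xi>\<^sup>2 / (2 * real n) = (cos \<theta>)\<^sup>2"
    unfolding x2 cos_double_cos using n by (simp add: field_simps)
  have "((cos \<theta>)\<^sup>2) powr (- 1 / 4) = cos \<theta> powr (- 1 / 2)"
    using c by (simp add: powr_powr flip: powr_numeral)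
  also have "\<dots> = 1 / sqrt (cos \<theta>)"
    using c by (simp add: powr_minus_divide powr_half_sqrt)
  finally have pw: "((cos \<theta>)\<^sup>2) powr (- 1 / 4) = 1 / sqrt (cos \<theta>)" .
  have ex: "real n / 2 * (ln (2 * real n) - 1) + \<xi>\<^sup>2 / 2 = real n / 2 * (ln (2 * real n) - cos (2 * \<theta>))"
    unfolding x2 by (simp add: field_simps)
  have "amplitude5 n \<xi> =
      sqrt (2 / cos \<theta>) * exp (real n / 2 * (ln (2 * real n) - cos (2 * \<theta>)))"
    unfolding amplitude5_def c2 pw ex by (simp add: real_sqrt_divide)
  moreover have "phase5 n \<xi> = Theta n \<theta>"
  proof -
    have "2 * real n - \<xi>\<^sup>2 = (r * cos \<theta>)\<^sup>2"
      unfolding \<xi> r(2)[symmetric] power_mult_distrib by (simp add: cos_squared_eq algebra_simps)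
    then have "sqrt (2 * real n - \<xi>\<^sup>2) = r * cos \<theta>" using c r by simp
    moreover have "\<xi> / 2 * (r * cos \<theta>) = real n / 2 * sin (2 * \<theta>)"
      using r(2) by (simp add: \<xi> sin_double power2_eq_square)
    ultimately show ?thesis
      unfolding phase5_def r_def[symmetric] \<theta>_def[symmetric] Theta_def
      by (simp add: algebra_simps)
  qed
  ultimately show ?thesis
    using Lambda5_sin[OF n \<theta>] \<xi> by (simp add: r_def)
qed

section \<open>Uniform asymptotics\<close>

text \<open>One uniform estimate serves both halves of the definition: where |cos| >= eta, one has
  |a| eta <= |g|, so the tolerance c * eta relative to a gives c relative to g.\<close>

lemma osc_asymp_equivI:
  assumes g: "\<And>n \<xi>. 1 \<le> n \<Longrightarrow> \<xi> \<in> S n \<Longrightarrow> g n \<xi> = of_real (a n \<xi> * cos (\<phi> n \<xi>))"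
    and diff: "\<And>\<epsilon>. 0 < \<epsilon> \<Longrightarrow> \<exists>N. \<forall>n\<ge>N. \<forall>\<xi>\<in>S n. norm (f n \<xi> - g n \<xi>) \<le> \<epsilon> * \<bar>a n \<xi>\<bar>"
  shows "osc_asymp_equiv S f g a \<phi>"
  unfolding osc_asymp_equiv_def
proof (intro conjI allI impI)
  show "(\<lambda>(n, \<xi>). f n \<xi> - g n \<xi>) \<in> o[uniformly_in S](\<lambda>(n, \<xi>). of_real (a n \<xi>))"
    by (rule landau_o.smallI) (use diff in \<open>auto simp: eventually_uniformly_in\<close>)
next
  fix \<eta> :: real
  assume \<eta>: "0 < \<eta>"
  let ?F = "uniformly_in (\<lambda>n. {\<xi> \<in> S n. \<eta> \<le> \<bar>cos (\<phi> n \<xi>)\<bar>})"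
  have "(\<lambda>x. (case x of (n, \<xi>) \<Rightarrow> f n \<xi>) - (case x of (n, \<xi>) \<Rightarrow> g n \<xi>)) \<in> o[?F](\<lambda>(n, \<xi>). g n \<xi>)"
  proof (rule landau_o.smallI)
    fix c :: real
    assume c: "0 < c"
    with \<eta> obtain N where N: "\<And>n \<xi>. n \<ge> N \<Longrightarrow> \<xi> \<in> S n \<Longrightarrow> norm (f n \<xi> - g n \<xi>) \<le> (c * \<eta>) * \<bar>a n \<xi>\<bar>"
      using diff[of "c * \<eta>"] by auto
    have "norm (f n \<xi> - g n \<xi>) \<le> c * norm (g n \<xi>)"
      if "n \<ge> max 1 N" "\<xi> \<in> S n" "\<eta> \<le> \<bar>cos (\<phi> n \<xi>)\<bar>" for n \<xi>
    proof -
      have "norm (f n \<xi> - g n \<xi>) \<le> c * (\<bar>a n \<xi>\<bar> * \<eta>)" using N[of n \<xi>] that by (simp add: mult_ac)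
      also have "\<dots> \<le> c * (\<bar>a n \<xi>\<bar> * \<bar>cos (\<phi> n \<xi>)\<bar>)"
        using c that by (intro mult_left_mono) auto
      also have "\<bar>a n \<xi>\<bar> * \<bar>cos (\<phi> n \<xi>)\<bar> = norm (g n \<xi>)"
        using that by (simp add: g abs_mult norm_mult)
      finally show ?thesis .
    qed
    then show "eventually (\<lambda>x. norm ((case x of (n, \<xi>) \<Rightarrow> f n \<xi>) - (case x of (n, \<xi>) \<Rightarrow> g n \<xi>))
        \<le> c * norm (case x of (n, \<xi>) \<Rightarrow> g n \<xi>)) ?F"
      unfolding eventually_uniformly_in by (intro exI[of _ "max 1 N"]) auto
  qed
  then show "(\<lambda>(n, \<xi>). f n \<xi>) \<sim>[?F] (\<lambda>(n, \<xi>). g n \<xi>)"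
    by (rule smallo_imp_asymp_equiv)
qed

section \<open>Comparison of the rescaled Hermite function with its WKB approximation\<close>

lemma wkb_amplitude_ge_1:
  assumes "\<bar>t\<bar> < 1"
  shows "1 \<le> wkb_amplitude t"
proof -
  have "1 - t\<^sup>2 > 0" using assms by (simp add: abs_square_less_1)
  then have "(1 - t\<^sup>2) powr 0 \<le> (1 - t\<^sup>2) powr (- 1 / 4)"
    by (intro powr_mono') auto
  then show ?thesis using \<open>1 - t\<^sup>2 > 0\<close> by (simp add: wkb_amplitude_def)
qed

lemma wkb_amplitude_le:
  assumes "\<bar>t\<bar> < 1"
  shows "wkb_amplitude t \<le> 1 / (1 - t\<^sup>2)"
proof -
  have "1 - t\<^sup>2 > 0" using assms by (simp add: abs_square_less_1)
  then have "(1 - t\<^sup>2) powr (- 1 / 4) \<le> (1 - t\<^sup>2) powr (- 1)"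
    by (intro powr_mono') auto
  then show ?thesis using \<open>1 - t\<^sup>2 > 0\<close> by (simp add: wkb_amplitude_def powr_minus_divide)
qed

text \<open>Put p = 1 - t^2 <= 1. All powers are coarsened to p^(-2), with total constant 1/4 + 5/4
  + 1 <= 3, and the amplitude costs one more factor 1/p.\<close>

lemma wkb_residual_bound:
  assumes \<delta>: "0 < \<delta>" "\<delta> \<le> 1 - t\<^sup>2"
  shows "\<bar>wkb_amplitude t * ((1 / (4 * (1 - t\<^sup>2)) + 5 * t\<^sup>2 / (4 * (1 - t\<^sup>2)\<^sup>2)) * cos x
    - t / ((1 - t\<^sup>2) * sqrt (1 - t\<^sup>2)) * sin x)\<bar> \<le> 3 / \<delta> ^ 3"
proof -
  define p where "p = 1 - t\<^sup>2"
  have p: "\<delta> \<le> p" "0 < p" "p \<le> 1" "t\<^sup>2 \<le> 1" using \<delta> by (auto simp: p_def)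
  have t: "\<bar>t\<bar> < 1" using p by (simp add: p_def flip: abs_square_less_1)
  have pp: "p\<^sup>2 \<le> p" using p by (simp add: power2_eq_square mult_left_le)
  have sq: "p \<le> sqrt p" using pp p by (auto intro: real_le_rsqrt)
  have "p * p \<le> p * sqrt p" using p sq by (intro mult_left_mono) auto
  then have ps: "p\<^sup>2 \<le> p * sqrt p" by (simp add: power2_eq_square)
  have a: "1 / (4 * p) \<le> (1 / 4) / p\<^sup>2" using p pp by (simp add: field_simps)
  have b: "5 * t\<^sup>2 / (4 * p\<^sup>2) \<le> (5 / 4) / p\<^sup>2" using p by (simp add: field_simps)
  have c: "\<bar>t / (p * sqrt p)\<bar> \<le> 1 / p\<^sup>2"
  proof -
    have "\<bar>t / (p * sqrt p)\<bar> = \<bar>t\<bar> / (p * sqrt p)" using p by (simp add: abs_mult)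
    also have "\<dots> \<le> 1 / p\<^sup>2" using t p ps by (intro frac_le) auto
    finally show ?thesis .
  qed
  define u v where "u = 1 / (4 * p) + 5 * t\<^sup>2 / (4 * p\<^sup>2)" and "v = t / (p * sqrt p)"
  have u: "\<bar>u\<bar> \<le> (3 / 2) / p\<^sup>2"
  proof -
    have "0 \<le> u" using p by (simp add: u_def)
    then show ?thesis using add_mono[OF a b] by (simp add: u_def)
  qed
  have "\<bar>u * cos x - v * sin x\<bar> \<le> \<bar>u\<bar> * \<bar>cos x\<bar> + \<bar>v\<bar> * \<bar>sin x\<bar>"
    by (metis abs_mult abs_triangle_ineq4)
  also have "\<dots> \<le> \<bar>u\<bar> * 1 + \<bar>v\<bar> * 1"
    by (intro add_mono mult_left_mono) auto
  also have "\<dots> \<le> (3 / 2) / p\<^sup>2 + 1 / p\<^sup>2"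
    using u c by (simp add: v_def)
  also have "\<dots> \<le> 3 / p\<^sup>2"
    using p by (simp add: divide_simps)
  finally have uv: "\<bar>u * cos x - v * sin x\<bar> \<le> 3 / p\<^sup>2" .
  have "\<bar>wkb_amplitude t * (u * cos x - v * sin x)\<bar> = wkb_amplitude t * \<bar>u * cos x - v * sin x\<bar>"
    using wkb_amplitude_ge_1[OF t] by (simp add: abs_mult)
  also have "\<dots> \<le> 1 / p * (3 / p\<^sup>2)"
    using uv wkb_amplitude_le[OF t] p by (intro mult_mono) (auto simp: p_def)
  also have "\<dots> = 3 / p ^ 3" by (simp add: power2_eq_square power3_eq_cube)
  also have "\<dots> \<le> 3 / \<delta> ^ 3"
    using p \<delta> by (intro divide_left_mono power_mono mult_pos_pos) auto
  finally show ?thesis unfolding u_def v_def p_def .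
qed

text \<open>The harmonic oscillator eigenfunction exp(-x^2/2) H_n(x) at x = sqrt(2n) t, up to
  normalisation. The Gaussian removes the first-order term from Hermite's equation.\<close>

definition hermite_fun :: "nat \<Rightarrow> real \<Rightarrow> real" where
  "hermite_fun n t = exp (- (real n * t\<^sup>2)) * Hermite n (sqrt (2 * real n) * t) / hermite_scale n"

definition hermite_fun' :: "nat \<Rightarrow> real \<Rightarrow> real" where
  "hermite_fun' n t = exp (- (real n * t\<^sup>2)) *
     (sqrt (2 * real n) * (2 * real n * Hermite (n - 1) (sqrt (2 * real n) * t))
       - 2 * real n * t * Hermite n (sqrt (2 * real n) * t)) / hermite_scale n"

lemma has_real_derivative_hermite_fun:
  "(hermite_fun n has_real_derivative hermite_fun' n t) (at t)"
proof -
  have H: "((\<lambda>t. Hermite n (r * t)) has_real_derivative 2 * real n * Hermite (n - 1) (r * t) * (r * 1)) (at t)" for r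
    by (rule DERIV_chain2[OF has_real_derivative_Hermite DERIV_cmult[OF DERIV_ident]])
  show ?thesis
    unfolding hermite_fun_def hermite_fun'_def
    by (rule derivative_eq_intros H refl)+
      (use hermite_scale_pos[of n] in \<open>simp_all add: field_simps\<close>)
qed

lemma has_real_derivative_hermite_fun':
  "(hermite_fun' n has_real_derivative
     - ((2 * real n)\<^sup>2 * (1 - t\<^sup>2) + 2 * real n) * hermite_fun n t) (at t)"
proof -
  define r where "r = sqrt (2 * real n)"
  have r: "r * r = 2 * real n" by (simp add: r_def)
  have H: "((\<lambda>t. Hermite n (r * t)) has_real_derivative 2 * real n * Hermite (n - 1) (r * t) * (r * 1)) (at t)"
    by (rule DERIV_chain2[OF has_real_derivative_Hermite DERIV_cmult[OF DERIV_ident]])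
  have H': "((\<lambda>t. 2 * real n * Hermite (n - 1) (r * t)) has_real_derivative
      (2 * (r * t) * (2 * real n * Hermite (n - 1) (r * t)) - 2 * real n * Hermite n (r * t)) * (r * 1)) (at t)"
    by (rule DERIV_chain2[OF Hermite_ode DERIV_cmult[OF DERIV_ident]])
  have E: "((\<lambda>t. exp (- (real n * t\<^sup>2))) has_real_derivative exp (- (real n * t\<^sup>2)) * (- (2 * real n * t))) (at t)"
    by (auto intro!: derivative_eq_intros)
  define N where "N = 2 * real n"
  define h g e where "h = Hermite n (r * t)" and "g = N * Hermite (n - 1) (r * t)"
    and "e = exp (- (real n * t\<^sup>2))"
  have "(hermite_fun' n has_real_derivative
      (e * (- (N * t)) * (r * g - N * t * h)
       + (r * ((2 * (r * t) * g - N * h) * (r * 1)) - (N * 1 * h + g * (r * 1) * (N * t))) * e)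
      / hermite_scale n) (at t)"
    unfolding hermite_fun'_def r_def[symmetric] N_def h_def g_def e_def
    by (intro DERIV_cdivide DERIV_mult DERIV_diff E H H' DERIV_cmult DERIV_ident)
  \<comment> \<open>The three multiples of r * g * N * t have coefficients -1, 2 and -1 and cancel,
    so only h survives.\<close>
  moreover have "e * (- (N * t)) * (r * g - N * t * h)
       + (r * ((2 * (r * t) * g - N * h) * (r * 1)) - (N * 1 * h + g * (r * 1) * (N * t))) * e
     = - (N\<^sup>2 * (1 - t\<^sup>2) + N) * (e * h)"
    unfolding r[folded N_def, symmetric] by (simp add: algebra_simps power2_eq_square)
  ultimately show ?thesis
    unfolding hermite_fun_def r_def[symmetric] unfolding N_def[symmetric] h_def[symmetric] e_def[symmetric]
    by simp
qed

lemma hermite_fun_asymp: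
  assumes \<delta>: "0 < \<delta>" "\<delta> < 1" and "0 < \<epsilon>"
  shows "\<exists>N. \<forall>n\<ge>N. \<forall>t. 0 \<le> t \<and> t \<le> 1 - \<delta> \<longrightarrow>
    \<bar>hermite_fun n t - wkb_amplitude t * cos (wkb_phase (2 * real n) t - real n * pi / 2)\<bar> \<le> \<epsilon>"
proof -
  define K where "K = 3 / \<delta> ^ 3"
  define D0 where "D0 n = Hermite n 0 / hermite_scale n - cos (real n * pi / 2)" for n
  \<comment> \<open>The phase has slope N + 1/2 at 0; divided by N = 2n this is 1 + 1/(4n).\<close>
  define D1 where "D1 n = sqrt (2 * real n) * Hermite (n - 1) 0 / hermite_scale n
    - (1 + 1 / (4 * real n)) * sin (real n * pi / 2)" for n
  have D0: "D0 \<longlonglongrightarrow> 0" unfolding D0_def by (rule Hermite_at_0_asymp)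
  have D1: "D1 \<longlonglongrightarrow> 0"
  proof -
    have "(\<lambda>n. 1 / (4 * real n) * sin (real n * pi / 2)) \<longlonglongrightarrow> 0"
      by (rule lim_null_mult_right_bounded[where B = 1]) (real_asymp, simp)
    from tendsto_diff[OF Hermite_pred_at_0_asymp this] show ?thesis
      unfolding D1_def by (simp add: algebra_simps)
  qed
  \<comment> \<open>\<open>G n\<close> bounds the squared error: it is the energy bound divided by
    N^2 * delta, with 3 >= exp t and 1 + 1/(2n) = (N^2 + N)/N^2.\<close>
  define G where "G n = 3 * ((D1 n)\<^sup>2 + (1 + 1 / (2 * real n)) * (D0 n)\<^sup>2 + K\<^sup>2 / (2 * real n)\<^sup>2) / \<delta>" for n
  have "G \<longlonglongrightarrow> 3 * (0\<^sup>2 + (1 + 0) * 0\<^sup>2 + 0) / \<delta>"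
    unfolding G_def using \<delta>
    by (intro tendsto_intros D0 D1) (real_asymp, real_asymp, simp)
  then have "eventually (\<lambda>n. G n < \<epsilon>\<^sup>2) sequentially"
    by (rule order_tendstoD) (use \<open>0 < \<epsilon>\<close> in simp)
  then obtain M where M: "\<And>n. n \<ge> M \<Longrightarrow> G n < \<epsilon>\<^sup>2" by (auto simp: eventually_sequentially)
  have "\<bar>hermite_fun n t - wkb_amplitude t * cos (wkb_phase (2 * real n) t - real n * pi / 2)\<bar> \<le> \<epsilon>"
    if n: "n \<ge> max 1 M" and t: "0 \<le> t" "t \<le> 1 - \<delta>" for n t
  proof -
    define N where "N = 2 * real n"
    have N: "N > 0" using n by (simp add: N_def)
    let ?\<Phi> = "\<lambda>s. wkb_phase N s - real n * pi / 2"
    define V' where "V' s = wkb_amplitude s * (s / (2 * (1 - s\<^sup>2)) * cos (?\<Phi> s)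
        - (N * sqrt (1 - s\<^sup>2) + 1 / (2 * sqrt (1 - s\<^sup>2))) * sin (?\<Phi> s))" for s
    define res where "res s = wkb_amplitude s * ((1 / (4 * (1 - s\<^sup>2)) + 5 * s\<^sup>2 / (4 * (1 - s\<^sup>2)\<^sup>2)) * cos (?\<Phi> s)
         - s / ((1 - s\<^sup>2) * sqrt (1 - s\<^sup>2)) * sin (?\<Phi> s))" for s
    define w where "w s = hermite_fun n s - wkb_amplitude s * cos (?\<Phi> s)" for s
    define w' where "w' s = hermite_fun' n s - V' s" for s
    have energy: "(w' t)\<^sup>2 + (N\<^sup>2 * (1 - t\<^sup>2) + N) * (w t)\<^sup>2 + K\<^sup>2
        \<le> exp t * ((w' 0)\<^sup>2 + (N\<^sup>2 + N) * (w 0)\<^sup>2 + K\<^sup>2)"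
    proof (rule oscillator_energy_bound[where e = res])
      fix s assume s: "0 \<le> s" "s \<le> t"
      then have s1: "\<bar>s\<bar> < 1" using t \<delta> by simp
      show "(w has_real_derivative w' s) (at s)"
        unfolding w_def w'_def V'_def
        by (intro DERIV_diff has_real_derivative_hermite_fun has_real_derivative_wkb(1) s1)
      have "(w' has_real_derivative - (N\<^sup>2 * (1 - s\<^sup>2) + N) * hermite_fun n s
          - (- (N\<^sup>2 * (1 - s\<^sup>2) + N) * (wkb_amplitude s * cos (?\<Phi> s)) + res s)) (at s)"
        unfolding w'_def V'_def res_def
        by (intro DERIV_diff has_real_derivative_hermite_fun'[of n, folded N_def] has_real_derivative_wkb(2) s1)
      then show "(w' has_real_derivative - (N\<^sup>2 * (1 - s\<^sup>2) + N) * w s - res s) (at s)"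
        by (simp add: w_def algebra_simps)
      \<comment> \<open>Hence 1 - s^2 >= 1 - s >= delta, as the residual bound requires.\<close>
      have "s\<^sup>2 \<le> s" using s1 s by (simp add: power2_eq_square mult_left_le)
      then show "\<bar>res s\<bar> \<le> K"
        unfolding res_def K_def using s t \<delta> by (intro wkb_residual_bound) auto
    qed (use N t \<delta> in auto)
    have w0: "w 0 = D0 n"
      by (simp add: w_def D0_def hermite_fun_def wkb_amplitude_def wkb_phase_def)
    have w'0: "w' 0 = N * D1 n"
      using N unfolding w'_def D1_def V'_def hermite_fun'_def N_def
      by (simp add: wkb_amplitude_def wkb_phase_def algebra_simps)
    have "exp t \<le> 3"
      using exp_le order_trans[of "exp t" "exp 1" 3] t \<delta> by simp
    moreover have "0 \<le> (w' 0)\<^sup>2 + (N\<^sup>2 + N) * (w 0)\<^sup>2 + K\<^sup>2" using N by simp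
    ultimately have "exp t * ((w' 0)\<^sup>2 + (N\<^sup>2 + N) * (w 0)\<^sup>2 + K\<^sup>2)
        \<le> 3 * ((w' 0)\<^sup>2 + (N\<^sup>2 + N) * (w 0)\<^sup>2 + K\<^sup>2)"
      by (rule mult_right_mono)
    also have "\<dots> = N\<^sup>2 * \<delta> * G n"
      using N \<delta> unfolding w0 w'0 G_def N_def[symmetric]
      by (simp add: field_simps power2_eq_square)
    also have "\<dots> \<le> N\<^sup>2 * \<delta> * \<epsilon>\<^sup>2"
      using M[of n] n \<delta> by (intro mult_left_mono) auto
    finally have up: "exp t * ((w' 0)\<^sup>2 + (N\<^sup>2 + N) * (w 0)\<^sup>2 + K\<^sup>2) \<le> N\<^sup>2 * \<delta> * \<epsilon>\<^sup>2" .
    have "t\<^sup>2 \<le> t" using t \<delta> by (simp add: power2_eq_square mult_left_le)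
    \<comment> \<open>As 1 - t^2 >= delta, the potential part of the energy dominates N^2 * delta
      times the squared error.\<close>
    then have "N\<^sup>2 * \<delta> * (w t)\<^sup>2 \<le> (N\<^sup>2 * (1 - t\<^sup>2) + N) * (w t)\<^sup>2"
      using t N by (intro mult_right_mono add_increasing2 mult_left_mono) auto
    also have "\<dots> \<le> (w' t)\<^sup>2 + (N\<^sup>2 * (1 - t\<^sup>2) + N) * (w t)\<^sup>2 + K\<^sup>2" by simp
    finally have "N\<^sup>2 * \<delta> * (w t)\<^sup>2 \<le> N\<^sup>2 * \<delta> * \<epsilon>\<^sup>2" using energy up by linarith
    then have "(w t)\<^sup>2 \<le> \<epsilon>\<^sup>2" using N \<delta> by simp
    then have "\<bar>w t\<bar> \<le> \<epsilon>" using \<open>0 < \<epsilon>\<close> by (simp add: abs_le_square_iff[symmetric])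
    then show ?thesis by (simp add: w_def N_def)
  qed
  then show ?thesis by blast
qed

section \<open>Return to the variable xi, and parity\<close>

lemma amplitude5_eq:
  assumes "1 \<le> n"
  shows "amplitude5 n (sqrt (2 * real n) * t) =
    hermite_scale n * exp (real n * t\<^sup>2) * wkb_amplitude t"
  using assms unfolding amplitude5_def hermite_scale_def wkb_amplitude_def
  by (simp add: power_mult_distrib exp_add)

lemma phase5_eq:
  assumes "1 \<le> n"
  shows "phase5 n (sqrt (2 * real n) * t) = wkb_phase (2 * real n) t - real n * pi / 2"
proof -
  define r where "r = sqrt (2 * real n)"
  have r: "r > 0" "r * r = 2 * real n" "r\<^sup>2 = 2 * real n" using assms by (auto simp: r_def)
  have "sqrt (2 * real n - (r * t)\<^sup>2) = sqrt (r\<^sup>2 * (1 - t\<^sup>2))"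
    unfolding r(3)[symmetric] by (simp add: power_mult_distrib algebra_simps)
  also have "\<dots> = r * sqrt (1 - t\<^sup>2)" using r(1) by (simp add: real_sqrt_mult)
  finally have "r * t / 2 * sqrt (2 * real n - (r * t)\<^sup>2) = (r * r) / 2 * (t * sqrt (1 - t\<^sup>2))"
    by simp
  then show ?thesis
    using r(1) unfolding phase5_def wkb_phase_def r_def[symmetric] r(2)
    by (simp add: algebra_simps)
qed

lemma Hermite_eq_hermite_fun:
  "Hermite n (sqrt (2 * real n) * t) = hermite_scale n * exp (real n * t\<^sup>2) * hermite_fun n t"
  using hermite_scale_pos[of n] by (simp add: hermite_fun_def exp_minus field_simps)

lemma amplitude5_minus: "amplitude5 n (- \<xi>) = amplitude5 n \<xi>"
  by (simp add: amplitude5_def)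

text \<open>The phase is an odd function minus n pi/2, so reflection sends it to -(phase + n pi).
  The sign agrees with \<open>Hermite_minus\<close>.\<close>

lemma cos_phase5_minus:
  assumes "\<bar>\<xi>\<bar> \<le> sqrt (2 * real n)"
  shows "cos (phase5 n (- \<xi>)) = (-1) ^ n * cos (phase5 n \<xi>)"
proof -
  have "\<bar>\<xi> / sqrt (2 * real n)\<bar> \<le> 1" using assms by (cases "n = 0") (auto simp: field_simps)
  then have "- 1 \<le> \<xi> / sqrt (2 * real n)" "\<xi> / sqrt (2 * real n) \<le> 1" by linarith+
  then have "arcsin (- \<xi> / sqrt (2 * real n)) = - arcsin (\<xi> / sqrt (2 * real n))"
    using arcsin_minus[of "\<xi> / sqrt (2 * real n)"] by simp
  then have eq: "phase5 n (- \<xi>) = - (phase5 n \<xi> + real n * pi)"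
    unfolding phase5_def by (simp add: algebra_simps)
  show ?thesis unfolding eq cos_minus by (simp add: cos_add)
qed

lemma Hermite_asymp_uniform:
  assumes \<delta>: "0 < \<delta>" "\<delta> < 1" and "0 < \<epsilon>"
  shows "\<exists>N. \<forall>n\<ge>N. \<forall>\<xi>. \<bar>\<xi>\<bar> \<le> (1 - \<delta>) * sqrt (2 * real n) \<longrightarrow>
    \<bar>Hermite n \<xi> - amplitude5 n \<xi> * cos (phase5 n \<xi>)\<bar> \<le> \<epsilon> * \<bar>amplitude5 n \<xi>\<bar>"
proof -
  obtain M where M: "\<And>n t. n \<ge> M \<Longrightarrow> 0 \<le> t \<Longrightarrow> t \<le> 1 - \<delta> \<Longrightarrow>
    \<bar>hermite_fun n t - wkb_amplitude t * cos (wkb_phase (2 * real n) t - real n * pi / 2)\<bar> \<le> \<epsilon>"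
    using hermite_fun_asymp[OF assms] by blast
  have pos: "\<bar>Hermite n \<xi> - amplitude5 n \<xi> * cos (phase5 n \<xi>)\<bar> \<le> \<epsilon> * \<bar>amplitude5 n \<xi>\<bar>"
    if n: "n \<ge> max 1 M" and \<xi>: "0 \<le> \<xi>" "\<xi> \<le> (1 - \<delta>) * sqrt (2 * real n)" for n \<xi>
  proof -
    have n1: "1 \<le> n" and r: "sqrt (2 * real n) > 0" using n by auto
    define t where "t = \<xi> / sqrt (2 * real n)"
    have t: "0 \<le> t" "t \<le> 1 - \<delta>" "\<xi> = sqrt (2 * real n) * t"
      using \<xi> r n1 by (auto simp: t_def divide_simps)
    define A where "A = hermite_scale n * exp (real n * t\<^sup>2)"
    have A: "A > 0" using hermite_scale_pos[of n] by (simp add: A_def)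
    have B: "1 \<le> wkb_amplitude t" using t \<delta> by (intro wkb_amplitude_ge_1) auto
    have "\<bar>Hermite n \<xi> - amplitude5 n \<xi> * cos (phase5 n \<xi>)\<bar> =
      \<bar>A * (hermite_fun n t - wkb_amplitude t * cos (wkb_phase (2 * real n) t - real n * pi / 2))\<bar>"
      unfolding t(3) amplitude5_eq[OF n1] phase5_eq[OF n1] Hermite_eq_hermite_fun A_def
      by (simp add: algebra_simps)
    also have "\<dots> \<le> A * \<epsilon>"
      using M[of n t] n t A by (simp add: abs_mult)
    \<comment> \<open>The amplitude is at least 1, so an absolute error in the rescaled problem is
      also a relative one.\<close>
    also have "\<dots> \<le> A * \<epsilon> * wkb_amplitude t"
      using mult_left_mono[OF B, of "A * \<epsilon>"] A \<open>0 < \<epsilon>\<close> by simp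
    also have "\<dots> = \<epsilon> * \<bar>amplitude5 n \<xi>\<bar>"
      unfolding t(3) amplitude5_eq[OF n1] A_def[symmetric] using A B by (simp add: abs_mult)
    finally show ?thesis .
  qed
  have "\<bar>Hermite n \<xi> - amplitude5 n \<xi> * cos (phase5 n \<xi>)\<bar> \<le> \<epsilon> * \<bar>amplitude5 n \<xi>\<bar>"
    if n: "n \<ge> max 1 M" and \<xi>: "\<bar>\<xi>\<bar> \<le> (1 - \<delta>) * sqrt (2 * real n)" for n \<xi>
  proof (cases "0 \<le> \<xi>")
    case True
    then show ?thesis using pos[OF n] \<xi> by simp
  next
    case False
    have "(1 - \<delta>) * sqrt (2 * real n) \<le> sqrt (2 * real n)"
      using \<delta> by (intro mult_left_le_one_le) auto
    then have "\<bar>\<xi>\<bar> \<le> sqrt (2 * real n)" using \<xi> by linarith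
    then have "Hermite n (- \<xi>) - amplitude5 n (- \<xi>) * cos (phase5 n (- \<xi>)) =
        (-1) ^ n * (Hermite n \<xi> - amplitude5 n \<xi> * cos (phase5 n \<xi>))"
      by (simp add: Hermite_minus amplitude5_minus cos_phase5_minus algebra_simps)
    then have "\<bar>Hermite n \<xi> - amplitude5 n \<xi> * cos (phase5 n \<xi>)\<bar> =
        \<bar>Hermite n (- \<xi>) - amplitude5 n (- \<xi>) * cos (phase5 n (- \<xi>))\<bar>"
      by (simp add: abs_mult power_abs)
    also have "\<dots> \<le> \<epsilon> * \<bar>amplitude5 n (- \<xi>)\<bar>"
      using pos[OF n, of "- \<xi>"] \<xi> False by simp
    finally show ?thesis by (simp add: amplitude5_minus)
  qed
  then show ?thesis by blast
qed

section \<open>Leading term on bounded xi-intervals\<close>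

lemma abs_cos_diff_le: "\<bar>cos x - cos y\<bar> \<le> \<bar>x - y :: real\<bar>"
proof -
  have "norm (cos x - cos y) \<le> 1 * norm (x - y)"
    by (rule field_differentiable_bound[of UNIV cos "\<lambda>x. - sin x"])
      (auto intro!: derivative_eq_intros)
  then show ?thesis by simp
qed

lemma Lambda5_lead_uniform:
  assumes "0 < \<epsilon>"
  shows "\<exists>N. \<forall>n\<ge>N. \<forall>\<xi>. \<bar>\<xi>\<bar> \<le> R \<longrightarrow>
    norm (Lambda5 n \<xi> - of_real (amplitude5_lead n \<xi> * cos (phase5_lead n \<xi>)))
      \<le> \<epsilon> * \<bar>amplitude5_lead n \<xi>\<bar>"
proof -
  \<comment> \<open>First summand: amplitude error, at most t^2/(1 - t^2) <= 2 t^2 <= R^2/n. Second: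
    phase error from \<open>wkb_phase_near_0\<close> with N t^2 <= R^2 and |t| <=
    |R|/sqrt(2n).\<close>
  define h where "h n = R\<^sup>2 * (1 / real n) + ((R\<^sup>2 + 1) * \<bar>R\<bar>) * (1 / sqrt (2 * real n))" for n
  have "h \<longlonglongrightarrow> R\<^sup>2 * 0 + ((R\<^sup>2 + 1) * \<bar>R\<bar>) * 0"
    unfolding h_def by (intro tendsto_intros) real_asymp
  then have "eventually (\<lambda>n. h n < \<epsilon>) sequentially"
    by (rule order_tendstoD) (use assms in simp)
  \<comment> \<open>This forces |t| <= 1/2, which \<open>wkb_phase_near_0\<close> needs and which
    puts xi inside the range of \<open>Lambda5_eq\<close>.\<close>
  moreover have "eventually (\<lambda>n. 2 * R\<^sup>2 \<le> real n) sequentially"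
    by real_asymp
  moreover have "eventually (\<lambda>n. 1 \<le> n) sequentially" by (rule eventually_ge_at_top)
  ultimately have "eventually (\<lambda>n. h n < \<epsilon> \<and> 2 * R\<^sup>2 \<le> real n \<and> 1 \<le> n) sequentially"
    by eventually_elim auto
  then obtain M where M: "\<And>n. n \<ge> M \<Longrightarrow> h n < \<epsilon> \<and> 2 * R\<^sup>2 \<le> real n \<and> 1 \<le> n"
    by (auto simp: eventually_sequentially)
  have "norm (Lambda5 n \<xi> - of_real (amplitude5_lead n \<xi> * cos (phase5_lead n \<xi>)))
      \<le> \<epsilon> * \<bar>amplitude5_lead n \<xi>\<bar>" if n: "n \<ge> M" and \<xi>: "\<bar>\<xi>\<bar> \<le> R" for n \<xi>
  proof -
    have n1: "1 \<le> n" and nR: "2 * R\<^sup>2 \<le> real n" and hn: "h n < \<epsilon>" using M[OF n] by auto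
    define r where "r = sqrt (2 * real n)"
    have r: "r > 0" "r * r = 2 * real n" "r\<^sup>2 = 2 * real n" using n1 by (auto simp: r_def)
    define t where "t = \<xi> / r"
    have t: "\<xi> = r * t" using r by (simp add: t_def)
    have "\<xi>\<^sup>2 \<le> R\<^sup>2" using \<xi> by (metis abs_ge_zero power2_abs power_mono)
    then have t2: "2 * real n * t\<^sup>2 \<le> R\<^sup>2" unfolding t power_mult_distrib r(3) .
    have t2': "t\<^sup>2 \<le> R\<^sup>2 / (2 * real n)" using t2 n1 by (simp add: field_simps)
    also have "\<dots> \<le> 1 / 4" using nR n1 by (simp add: field_simps)
    finally have t4: "t\<^sup>2 \<le> (1 / 2)\<^sup>2" by (simp add: power2_eq_square)
    then have th: "\<bar>t\<bar> \<le> 1 / 2" by (simp add: abs_le_square_iff[symmetric])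
    define A where "A = hermite_scale n * exp (real n * t\<^sup>2)"
    have A: "A > 0" using hermite_scale_pos[of n] by (simp add: A_def)
    have lead: "amplitude5_lead n \<xi> = A"
      unfolding amplitude5_lead_def A_def hermite_scale_def t power_mult_distrib r(3)
      by (simp add: exp_add)
    let ?x = "wkb_phase (2 * real n) t - real n * pi / 2"
    let ?y = "2 * real n * t - real n * pi / 2"
    \<comment> \<open>The leading phase is stated with the opposite sign; evenness of the cosine
      absorbs this.\<close>
    have "phase5_lead n \<xi> = - ?y"
      unfolding phase5_lead_def r_def[symmetric] t using r(2) by (simp add: mult.commute mult.left_commute)
    then have cl: "cos (phase5_lead n \<xi>) = cos ?y" by (simp only: cos_minus)
    have amp: "wkb_amplitude t - 1 \<le> R\<^sup>2 * (1 / real n)"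
    proof -
      have "wkb_amplitude t - 1 \<le> 1 / (1 - t\<^sup>2) - 1" using wkb_amplitude_le[of t] th by simp
      also have "\<dots> = t\<^sup>2 / (1 - t\<^sup>2)" using t4 by (simp add: field_simps power2_eq_square)
      also have "\<dots> \<le> t\<^sup>2 / (1 / 2)" using t4 by (intro divide_left_mono) (auto simp: power2_eq_square)
      also have "\<dots> \<le> R\<^sup>2 * (1 / real n)" using t2 n1 by (simp add: field_simps)
      finally show ?thesis .
    qed
    have "\<bar>cos ?x - cos ?y\<bar> \<le> \<bar>wkb_phase (2 * real n) t - 2 * real n * t\<bar>"
      using abs_cos_diff_le[of ?x ?y] by simp
    also have "\<dots> \<le> (2 * real n * t\<^sup>2 + 1) * \<bar>t\<bar>"
      by (rule wkb_phase_near_0) (use th in auto)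
    also have "\<dots> \<le> (R\<^sup>2 + 1) * (\<bar>R\<bar> / r)"
      using t2 \<xi> r by (intro mult_mono) (auto simp: t_def abs_mult divide_right_mono)
    finally have ph: "\<bar>cos ?x - cos ?y\<bar> \<le> (R\<^sup>2 + 1) * \<bar>R\<bar> * (1 / r)" by simp
    have "Lambda5 n \<xi> = of_real (amplitude5 n \<xi> * cos (phase5 n \<xi>))"
    proof (rule Lambda5_eq[OF n1])
      have "r * \<bar>t\<bar> < r * 1" using th r by (intro mult_strict_left_mono) auto
      then show "\<bar>\<xi>\<bar> < sqrt (2 * real n)" unfolding r_def[symmetric] t using r by (simp add: abs_mult)
    qed
    also have "\<dots> = of_real (A * wkb_amplitude t * cos ?x)"
      unfolding t r_def amplitude5_eq[OF n1] phase5_eq[OF n1] A_def ..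
    finally have "norm (Lambda5 n \<xi> - of_real (amplitude5_lead n \<xi> * cos (phase5_lead n \<xi>))) =
        norm (of_real (A * ((wkb_amplitude t - 1) * cos ?x + (cos ?x - cos ?y))) :: complex)"
      unfolding lead cl by (simp add: algebra_simps)
    also have "\<dots> = A * \<bar>(wkb_amplitude t - 1) * cos ?x + (cos ?x - cos ?y)\<bar>"
      unfolding norm_of_real using A by (simp add: abs_mult)
    also have "\<dots> \<le> A * h n"
    proof (intro mult_left_mono)
      have "\<bar>(wkb_amplitude t - 1) * cos ?x\<bar> \<le> wkb_amplitude t - 1"
        using wkb_amplitude_ge_1[of t] th by (simp add: abs_mult mult_left_le)
      then show "\<bar>(wkb_amplitude t - 1) * cos ?x + (cos ?x - cos ?y)\<bar> \<le> h n"
        unfolding h_def r_def[symmetric] using amp ph by linarith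
    qed (use A in simp)
    also have "\<dots> \<le> A * \<epsilon>" using A hn by simp
    finally show ?thesis unfolding lead using A by (simp add: mult.commute)
  qed
  then show ?thesis by blast
qed

text \<open>The region well inside the turning points is read as |xi| <= (1 - delta) sqrt(2n) for
  each fixed delta. The leading term is taken for bounded xi because linearising the phase costs an
  error of order (xi^2 + 1)|xi|/sqrt n.\<close>

theorem mainTheorem3:
  shows
    "(\<forall>\<delta>. 0 < \<delta> \<and> \<delta> < 1 \<longrightarrow>
        osc_asymp_equiv (\<lambda>n. {\<xi>. \<bar>\<xi>\<bar> \<le> (1 - \<delta>) * sqrt (2 * real n)})
          (\<lambda>n \<xi>. of_real (Hermite n \<xi>)) Lambda5 amplitude5 phase5)
   \<and> (\<forall>n \<theta>. 1 \<le> n \<and> - pi / 2 < \<theta> \<and> \<theta> < pi / 2 \<longrightarrow>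
        sigma n (sqrt (2 * real n) * sin \<theta>) = \<i> * of_real (sqrt (2 * real n) * cos \<theta>) \<and>
        Lambda5 n (sqrt (2 * real n) * sin \<theta>) =
          of_real (sqrt (2 / cos \<theta>) * exp (real n / 2 * (ln (2 * real n) - cos (2 * \<theta>)))
                     * cos (Theta n \<theta>)))
   \<and> (\<forall>n \<xi>. 1 \<le> n \<and> \<bar>\<xi>\<bar> < sqrt (2 * real n) \<longrightarrow>
        Lambda5 n \<xi> = of_real (amplitude5 n \<xi> * cos (phase5 n \<xi>)))
   \<and> (\<forall>R. osc_asymp_equiv (\<lambda>n. {\<xi>. \<bar>\<xi>\<bar> \<le> R})
          Lambda5 (\<lambda>n \<xi>. of_real (amplitude5_lead n \<xi> * cos (phase5_lead n \<xi>)))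
          amplitude5_lead phase5_lead)"
proof (intro conjI allI impI)
  fix \<delta> :: real
  assume "0 < \<delta> \<and> \<delta> < 1"
  then have \<delta>: "0 < \<delta>" "\<delta> < 1" by auto
  have L: "Lambda5 n \<xi> = of_real (amplitude5 n \<xi> * cos (phase5 n \<xi>))"
    if "1 \<le> n" "\<bar>\<xi>\<bar> \<le> (1 - \<delta>) * sqrt (2 * real n)" for n \<xi>
  proof (rule Lambda5_eq[OF that(1)])
    have "(1 - \<delta>) * sqrt (2 * real n) < 1 * sqrt (2 * real n)"
      using that \<delta> by (intro mult_strict_right_mono) auto
    then show "\<bar>\<xi>\<bar> < sqrt (2 * real n)" using that by linarith
  qed
  show "osc_asymp_equiv (\<lambda>n. {\<xi>. \<bar>\<xi>\<bar> \<le> (1 - \<delta>) * sqrt (2 * real n)})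
          (\<lambda>n \<xi>. of_real (Hermite n \<xi>)) Lambda5 amplitude5 phase5"
  proof (rule osc_asymp_equivI)
    fix \<epsilon> :: real
    assume "0 < \<epsilon>"
    from Hermite_asymp_uniform[OF \<delta> this] obtain M where
      M: "\<And>n \<xi>. n \<ge> M \<Longrightarrow> \<bar>\<xi>\<bar> \<le> (1 - \<delta>) * sqrt (2 * real n) \<Longrightarrow>
        \<bar>Hermite n \<xi> - amplitude5 n \<xi> * cos (phase5 n \<xi>)\<bar> \<le> \<epsilon> * \<bar>amplitude5 n \<xi>\<bar>" by blast
    have "norm (complex_of_real (Hermite n \<xi>) - Lambda5 n \<xi>) \<le> \<epsilon> * \<bar>amplitude5 n \<xi>\<bar>"
      if "n \<ge> max 1 M" "\<bar>\<xi>\<bar> \<le> (1 - \<delta>) * sqrt (2 * real n)" for n \<xi>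
    proof -
      have "complex_of_real (Hermite n \<xi>) - Lambda5 n \<xi> =
          of_real (Hermite n \<xi> - amplitude5 n \<xi> * cos (phase5 n \<xi>))"
        using that by (subst L) auto
      then show ?thesis using M[of n \<xi>] that by (simp only: norm_of_real)
    qed
    then show "\<exists>N. \<forall>n\<ge>N. \<forall>\<xi>\<in>{\<xi>. \<bar>\<xi>\<bar> \<le> (1 - \<delta>) * sqrt (2 * real n)}.
        norm (complex_of_real (Hermite n \<xi>) - Lambda5 n \<xi>) \<le> \<epsilon> * \<bar>amplitude5 n \<xi>\<bar>"
      by (intro exI[of _ "max 1 M"]) auto
  qed (use L in auto)
next
  fix R :: real
  show "osc_asymp_equiv (\<lambda>n. {\<xi>. \<bar>\<xi>\<bar> \<le> R})
          Lambda5 (\<lambda>n \<xi>. of_real (amplitude5_lead n \<xi> * cos (phase5_lead n \<xi>)))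
          amplitude5_lead phase5_lead"
    by (rule osc_asymp_equivI) (use Lambda5_lead_uniform in auto)
qed (use sigma_sin Lambda5_sin Lambda5_eq in auto)

end
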